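(* Let $L=(G,l)$ be a linkage with $M(L)\ne\emptyset$, and suppose there are vertices $u\ne v$ of $G$ with \[(G,u,v)=(P_1,u,v)\|(P_2,u,v)\|\cdots\|(P_n,u,v)\|(K,u,v),\qquad n\ge2,\] where each $P_i$ is a path graph joining $u$ and $v$ whose edges all have positive length, and $K$ is either empty (the factor being absent) or such that $(K,u,v)$ is a TTSPG; let $L_K=(K,l|_K)$. Regard each $P_i$ as a path linkage with restricted lengths and terminals $u,v$, and write $[P_i]=[a_i,b_i]$. Let $a=\max_i a_i$ and $b=\min_i b_i$ (so $a\le b$). Let $Q$ be a path linkage with terminal vertices $s,t$ and four edges $e_1,\dots,e_4$ of lengths $\frac{a+b}{2},\frac{b-a}{6},\frac{b-a}{6},\frac{b-a}{6}$, and let $L_1$ be the linkage defined by $(L_1,u,v)=(Q,s,t)\|(L_K,u,v)$ (i.e. $L$ with all the $P_i$ replaced by the single path $Q$; if $K$ is empty, $L_1=Q$ with $u=s,v=t$). Suppose $\nabla(P_i)\cap[L,u,v]\ne\emptyset$ for every $i=1,\dots,n$. Then $M(L)$ is connected if and only if $M(L_1)$ is connected.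
   Context: A graph has a finite vertex set and a finite multiset of edges that are unordered pairs of distinct vertices. A linkage is $L=(G,l)$ with $l:E\to\mathbb R_{\ge0}$; $C(L)=\{p:V\to\mathbb R^2:|p(u)-p(v)|=l(\{u,v\})\ \forall\{u,v\}\in E\}$, and $M(L)$ is the quotient of $C(L)$ by the group of orientation preserving isometries of $\mathbb R^2$ (quotient topology). $[L,u,v]=\{|p(u)-p(v)|:p\in M(L)\}$. Parallel composition of TTGs (and linkages, with lengths carried along): $(G_1,s_1,t_1)\|(G_2,s_2,t_2)=(G_1\cup_{s_1\sim s_2,t_1\sim t_2}G_2,s_1,t_1)$; series composition $(G_1,s_1,t_1)\circ(G_2,s_2,t_2)=(G_1\cup_{t_2\sim s_1}G_2,s_2,t_1)$; TTSPGs form the smallest class of TTGs containing a single edge and closed under both compositions. For a path linkage $P$ with endpoints $s,t$, $\theta:M(P)\to\mathbb R$, $\theta(p)=|p(s)-p(t)|$, $[P]=\theta(M(P))$ (a closed interval), and $\nabla(P)=\{x\in[P]:\theta^{-1}(x)\text{ is connected}\}$. *)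

theory Defs
  imports "HOL-Analysis.Analysis"
begin

text \<open>A linkage: finite vertex set, finite set of edge names (so parallel edges /
a multiset of edges are allowed), the two endpoints of each edge, and edge lengths.
The plane R^2 is identified with the complex numbers.\<close>

record ('v, 'e) linkage =
  lverts :: "'v set"
  ledges :: "'e set"
  lends  :: "'e \<Rightarrow> 'v set"
  llen   :: "'e \<Rightarrow> real"

definition wf_linkage :: "('v, 'e) linkage \<Rightarrow> bool" where
  "wf_linkage L \<longleftrightarrow> finite (lverts L) \<and> finite (ledges L) \<and>
     (\<forall>e\<in>ledges L. lends L e \<subseteq> lverts L \<and> card (lends L e) = 2 \<and> llen L e \<ge> 0)"

definition Cfg :: "('v, 'e) linkage \<Rightarrow> ('v \<Rightarrow> complex) set" where
  "Cfg L = {p. (\<forall>x. x \<notin> lverts L \<longrightarrow> p x = 0) \<and>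
     (\<forall>e\<in>ledges L. \<forall>x y. lends L e = {x, y} \<longrightarrow> cmod (p x - p y) = llen L e)}"

definition congr :: "('v, 'e) linkage \<Rightarrow> ('v \<Rightarrow> complex) \<Rightarrow> ('v \<Rightarrow> complex) \<Rightarrow> bool" where
  "congr L p q \<longleftrightarrow> (\<exists>a b. cmod a = 1 \<and> (\<forall>x\<in>lverts L. q x = a * p x + b))"

definition quotient_topology :: "'a topology \<Rightarrow> ('a \<Rightarrow> 'a \<Rightarrow> bool) \<Rightarrow> 'a set topology" where
  "quotient_topology X R = topology (\<lambda>U. U \<subseteq> (\<lambda>x. {y \<in> topspace X. R x y}) ` topspace X
                                          \<and> openin X (\<Union>U))"

text \<open>The moduli space M(L) with the quotient topology (C(L) carries the subspace
topology of the product topology on V -> R^2).\<close>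
definition Mtop :: "('v, 'e) linkage \<Rightarrow> ('v \<Rightarrow> complex) set topology" where
  "Mtop L = quotient_topology (top_of_set (Cfg L)) (congr L)"

text \<open>[L,u,v]: the set of realised distances (the distance is invariant under isometries).\<close>
definition dists :: "('v, 'e) linkage \<Rightarrow> 'v \<Rightarrow> 'v \<Rightarrow> real set" where
  "dists L u v = {cmod (p u - p v) | p. p \<in> Cfg L}"

definition nabla :: "('v, 'e) linkage \<Rightarrow> 'v \<Rightarrow> 'v \<Rightarrow> real set" where
  "nabla P u v = {x \<in> dists P u v.
     connectedin (Mtop P) {c \<in> topspace (Mtop P). \<exists>p\<in>c. cmod (p u - p v) = x}}"

definition is_path :: "('v, 'e) linkage \<Rightarrow> 'e set \<Rightarrow> 'v list \<Rightarrow> bool" where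
  "is_path L Es xs \<longleftrightarrow> length xs \<ge> 2 \<and> distinct xs \<and> Es \<subseteq> ledges L \<and>
     bij_betw (lends L) Es {{xs ! j, xs ! Suc j} | j. Suc j < length xs}"

definition sublk :: "('v, 'e) linkage \<Rightarrow> 'v set \<Rightarrow> 'e set \<Rightarrow> ('v, 'e) linkage" where
  "sublk L Vs Es = L\<lparr>lverts := Vs, ledges := Es\<rparr>"

abbreviation everts :: "('v, 'e) linkage \<Rightarrow> 'e set \<Rightarrow> 'v set" where
  "everts L Es \<equiv> \<Union> (lends L ` Es)"

text \<open>ttsp L Es s t: the subgraph of L formed by the edges Es (and their endpoints)
with terminals s, t is a two-terminal series-parallel graph.  Parallel composition
glues only the terminals, series composition (G1,m,t) o (G2,s,m) = (G1 glued with G2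
at m, s, t) glues only at the one vertex m.\<close>
inductive ttsp :: "('v, 'e) linkage \<Rightarrow> 'e set \<Rightarrow> 'v \<Rightarrow> 'v \<Rightarrow> bool" for L where
  edge: "e \<in> ledges L \<Longrightarrow> lends L e = {s, t} \<Longrightarrow> s \<noteq> t \<Longrightarrow> ttsp L {e} s t"
| par: "ttsp L E1 s t \<Longrightarrow> ttsp L E2 s t \<Longrightarrow> E1 \<inter> E2 = {} \<Longrightarrow>
        everts L E1 \<inter> everts L E2 = {s, t} \<Longrightarrow> ttsp L (E1 \<union> E2) s t"
| ser: "ttsp L E1 m t \<Longrightarrow> ttsp L E2 s m \<Longrightarrow> E1 \<inter> E2 = {} \<Longrightarrow>
        everts L E1 \<inter> everts L E2 = {m} \<Longrightarrow> ttsp L (E1 \<union> E2) s t"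

text \<open>L1 = (Q,s,t) || (L_K,u,v): the K-part of L (edges EK, vertex set their endpoints
plus u, v) in parallel with the path Q = u - q1 - q2 - q3 - v with edge lengths
(a+b)/2, (b-a)/6, (b-a)/6, (b-a)/6 (new vertices/edges are tagged with Inr).\<close>
definition L1 :: "('v, 'e) linkage \<Rightarrow> 'e set \<Rightarrow> 'v \<Rightarrow> 'v \<Rightarrow> real \<Rightarrow> real
                  \<Rightarrow> ('v + nat, 'e + nat) linkage" where
  "L1 L EK u v a b = \<lparr>
     lverts = Inl ` (everts L EK \<union> {u, v}) \<union> Inr ` {1, 2, 3},
     ledges = Inl ` EK \<union> Inr ` {1, 2, 3, 4},
     lends = (\<lambda>e. case e of Inl e' \<Rightarrow> Inl ` lends L e'
                 | Inr k \<Rightarrow> (if k = 1 then {Inl u, Inr 1}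
                            else if k = 2 then {Inr 1, Inr 2}
                            else if k = 3 then {Inr 2, Inr 3}
                            else {Inr 3, Inl v})),
     llen = (\<lambda>e. case e of Inl e' \<Rightarrow> llen L e'
                 | Inr k \<Rightarrow> (if k = 1 then (a + b) / 2 else (b - a) / 6)) \<rparr>"

end

theory Submission
  imports Defs
begin

text \<open>
  M(L) is connected if and only if C(L) is, since the isometry classes are connected. Deleting all the
  paths from L, or Q from L1, leaves the same space X of configurations of K together with u, v
  whose distance |p(u) - p(v)| lies in [a, b]. It is a continuous image of both C(L) and C(L1), so
  everything comes down to lifting connectedness back along the attachment of a path. Up to
  rotation, attaching a path is the pullback of the end-to-end distance of the path along the
  distance on X. This distance function has only global extrema, hence is open onto its range.
  A pullback of such a map over a connected space is connected as soon as one fibre is, because the two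
  parts of a separation would both have clopen images. For the paths of L the connected fibre comes
  from the hypothesis on nabla; for Q every fibre is connected.
\<close>

section \<open>Pullbacks over connected spaces\<close>

text \<open>An attached path has to match the displacement vector of the terminals, while openness
  and the hypothesis on \<open>nabla\<close> speak only of its length. Openness is proved for
  positive edge lengths. Q violates this when a = b, so the pullback lemma asks at each point of the
  base for either openness or a connected fibre. The constants of Q: with M = (a+b)/2 and c =
  (b-a)/6 the short edges together reach 3c = (b-a)/2, so Q attains exactly the distances from M -
  3c = a to M + 3c = b, and a \<ge> 0 says that 3c \<le> M. A single edge of length 3c in their
  place would attain the same distances, but would leave two mirror-image triangles at every
  interior distance. Three short edges can fold, and the mirror images become joined through the
  positions in which they are stretched straight.\<close>

lemma closedin_fst_image_compact:
  fixes Y :: "'a::topological_space set" and T :: "'b::topological_space set"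
  assumes "compact T" "closedin (top_of_set (Y \<times> T)) C"
  shows "closedin (top_of_set Y) (fst ` C)"
proof -
  have "compact_space (top_of_set T)"
    using assms(1) by (simp add: compact_space_subtopology)
  then have "closed_map (prod_topology (top_of_set Y) (top_of_set T)) (top_of_set Y) fst"
    by (rule Abstract_Topological_Spaces.closed_map_fst)
  moreover have "prod_topology (top_of_set Y) (top_of_set T) = top_of_set (Y \<times> T)"
    by (simp add: subtopology_Times)
  ultimately show ?thesis
    using assms(2) by (simp add: closed_map_def)
qed

lemma closedin_top_of_set_compl:
  assumes "openin (top_of_set E) A"
  shows "closedin (top_of_set E) (E - A)"
  using closedin_diff[OF closedin_topspace assms] by simp

lemma openin_top_of_set_compl:
  assumes "closedin (top_of_set E) A"
  shows "openin (top_of_set E) (E - A)"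
  using openin_diff[OF openin_topspace assms] by simp

lemma connected_subset_clopen:
  assumes "openin (top_of_set E) A" "closedin (top_of_set E) A" "connected S" "S \<subseteq> E" "S \<inter> A \<noteq> {}"
  shows "S \<subseteq> A"
proof -
  have "openin (top_of_set S) (S \<inter> A)"
  proof -
    obtain U where "open U" "A = E \<inter> U" using assms(1) by (auto simp: openin_open)
    then have "open U" "S \<inter> A = S \<inter> U" using assms(4) by auto
    then show ?thesis by (auto simp: openin_open)
  qed
  moreover have "closedin (top_of_set S) (S \<inter> A)"
  proof -
    obtain U where "closed U" "A = E \<inter> U" using assms(2) by (auto simp: closedin_closed)
    then have "closed U" "S \<inter> A = S \<inter> U" using assms(4) by auto
    then show ?thesis by (auto simp: closedin_closed)
  qed
  ultimately show ?thesis
    using assms(3,5) unfolding connected_clopen by blast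
qed

text \<open>Clopen parts of the pullback have clopen projections to \<open>Y\<close>: closed because
  \<open>T\<close> is compact, open because each point has either a connected fibre or local
  openness of \<open>h\<close>. The alternative is posed point by point, so different points of
  \<open>Y\<close> may use different halves. Both parts of a separation would thus meet the
  connected fibre over \<open>y1\<close>.\<close>

lemma connected_fibre_product:
  fixes Y :: "'a::topological_space set" and T :: "'b::topological_space set"
    and d :: "'a \<Rightarrow> real" and h :: "'b \<Rightarrow> real"
  assumes Y: "connected Y" and d: "continuous_on Y d"
    and T: "compact T" and h: "continuous_on T h"
    and sub: "d ` Y \<subseteq> h ` T"
    and lev: "\<And>y. y \<in> Y \<Longrightarrow> connected {z\<in>T. h z = d y} \<or>
        (\<forall>z0\<in>T. h z0 = d y \<longrightarrow> (\<forall>U. open U \<longrightarrow> z0 \<in> U \<longrightarrow>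
           (\<exists>\<delta>>0. \<forall>t\<in>h ` T. \<bar>t - d y\<bar> < \<delta> \<longrightarrow> (\<exists>z\<in>T \<inter> U. h z = t))))"
    and one: "y1 \<in> Y" "connected {z\<in>T. h z = d y1}"
  shows "connected {(y,z). y \<in> Y \<and> z \<in> T \<and> h z = d y}" (is "connected ?E")
proof -
  have Ecl: "closedin (top_of_set (Y \<times> T)) ?E"
  proof -
    have "continuous_on (Y \<times> T) (\<lambda>p. h (snd p) - d (fst p))"
      by (intro continuous_intros continuous_on_compose2[OF h] continuous_on_compose2[OF d]) auto
    then have "closedin (top_of_set (Y \<times> T)) ((Y \<times> T) \<inter> (\<lambda>p. h (snd p) - d (fst p)) -` {0})"
      by (rule continuous_closedin_preimage) simp
    moreover have "(Y \<times> T) \<inter> (\<lambda>p. h (snd p) - d (fst p)) -` {0} = ?E" by auto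
    ultimately show ?thesis by simp
  qed
  have sub': "\<exists>z\<in>T. h z = d y" if "y \<in> Y" for y
    using sub that unfolding image_subset_iff image_iff by metis
  have fib: "connected ({y} \<times> {z\<in>T. h z = d y})" if "connected {z\<in>T. h z = d y}" for y
    using that by (simp add: connected_Times)
  have clopen: "openin (top_of_set Y) (fst ` A) \<and> closedin (top_of_set Y) (fst ` A)"
    if A: "openin (top_of_set ?E) A" "closedin (top_of_set ?E) A" for A
  proof
    have cl: "closedin (top_of_set Y) (fst ` B)" if "closedin (top_of_set ?E) B" for B
      using closedin_fst_image_compact[OF T] closedin_trans[OF that Ecl] by blast
    then show "closedin (top_of_set Y) (fst ` A)" using A by blast
    have AE: "A \<subseteq> ?E" using A(1) openin_imp_subset by blast
    show "openin (top_of_set Y) (fst ` A)"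
    proof (subst openin_subopen, intro ballI)
      fix y0 assume "y0 \<in> fst ` A"
      then obtain z0 where z0: "(y0,z0) \<in> A" by auto
      then have y0: "y0 \<in> Y" "z0 \<in> T" "h z0 = d y0" using AE by auto
      show "\<exists>N. openin (top_of_set Y) N \<and> y0 \<in> N \<and> N \<subseteq> fst ` A"
      proof (cases "connected {z\<in>T. h z = d y0}")
        case True
        \<comment> \<open>A connected fibre lies wholly on one side, so \<open>y0\<close> is outside
          the closed projection of the other side, and so is a neighbourhood of
          \<open>y0\<close>.\<close>
        have fA: "{y0} \<times> {z\<in>T. h z = d y0} \<subseteq> A"
          by (rule connected_subset_clopen[OF A fib[OF True]]) (use y0 z0 in auto)
        have "closedin (top_of_set ?E) (?E - A)"
          using A(1) by (rule closedin_top_of_set_compl)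
        then have "closedin (top_of_set Y) (fst ` (?E - A))" by (rule cl)
        then have "openin (top_of_set Y) (Y - fst ` (?E - A))"
          by (rule openin_top_of_set_compl)
        moreover have "(y0,b) \<in> A" if "(y0,b) \<in> ?E" for b using fA that by blast
        then have "y0 \<in> Y - fst ` (?E - A)" using y0 by fastforce
        moreover have "Y - fst ` (?E - A) \<subseteq> fst ` A"
        proof
          fix y assume y: "y \<in> Y - fst ` (?E - A)"
          then obtain z where "z \<in> T" "h z = d y" using sub' by blast
          then have "(y,z) \<in> ?E" using y by auto
          then have "(y,z) \<in> A" using y by force
          then show "y \<in> fst ` A" by force
        qed
        ultimately show ?thesis by blast
      next
        case False
        obtain O' where O: "open O'" "A = ?E \<inter> O'" using A(1) by (auto simp: openin_open)
        then have "(y0,z0) \<in> O'" using z0 by blast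
        from open_prod_elim[OF O(1) this] obtain V U
          where VU: "open V" "open U" "(y0,z0) \<in> V \<times> U" "V \<times> U \<subseteq> O'" by blast
        then have z0U: "z0 \<in> U" by blast
        from lev[OF y0(1)] False have op: "\<forall>z0\<in>T. h z0 = d y0 \<longrightarrow> (\<forall>U. open U \<longrightarrow> z0 \<in> U \<longrightarrow>
           (\<exists>\<delta>>0. \<forall>t\<in>h ` T. \<bar>t - d y0\<bar> < \<delta> \<longrightarrow> (\<exists>z\<in>T \<inter> U. h z = t)))" by simp
        then obtain \<delta> where \<delta>: "\<delta> > 0" "\<forall>t\<in>h ` T. \<bar>t - d y0\<bar> < \<delta> \<longrightarrow> (\<exists>z\<in>T \<inter> U. h z = t)"
          using op[rule_format, OF y0(2,3) VU(2) z0U] by (elim exE conjE) blast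
        \<comment> \<open>The bound on \<open>d\<close> lets openness produce a partner
          \<open>z\<close> in \<open>U\<close>; membership in \<open>V\<close> then puts
          \<open>(y,z)\<close> into the box inside \<open>O'\<close>.\<close>
        let ?N = "(Y \<inter> d -` ball (d y0) \<delta>) \<inter> V"
        have "openin (top_of_set Y) ?N"
          by (intro openin_Int_open continuous_openin_preimage_gen d VU) simp
        moreover have "y0 \<in> ?N" using y0 VU \<delta> by auto
        moreover have "?N \<subseteq> fst ` A"
        proof
          fix y assume y: "y \<in> ?N"
          then have "\<bar>d y - d y0\<bar> < \<delta>" "d y \<in> h ` T"
            using sub by (auto simp: dist_real_def abs_minus_commute)
          then obtain z where "z \<in> T \<inter> U" "h z = d y" using \<delta> by blast
          then have "(y,z) \<in> ?E" "(y,z) \<in> O'" using VU y by auto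
          then have "(y,z) \<in> A" using O by blast
          then show "y \<in> fst ` A" by force
        qed
        ultimately show ?thesis by blast
      qed
    qed
  qed
  show ?thesis
    unfolding connected_clopen
  proof (intro allI impI)
    fix A assume A: "openin (top_of_set ?E) A \<and> closedin (top_of_set ?E) A"
    let ?B = "?E - A"
    have AE: "A \<subseteq> ?E" using A openin_imp_subset by blast
    have B: "openin (top_of_set ?E) ?B" "closedin (top_of_set ?E) ?B"
      using A openin_top_of_set_compl closedin_top_of_set_compl by blast+
    show "A = {} \<or> A = ?E"
    proof (rule ccontr)
      assume "\<not> (A = {} \<or> A = ?E)"
      then have ne: "A \<noteq> {}" "?B \<noteq> {}" using AE by auto
      have "fst ` A = Y"
        using clopen A Y ne unfolding connected_clopen by blast
      moreover have "fst ` ?B = Y"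
        using clopen[OF B] Y ne(2) unfolding connected_clopen by blast
      ultimately have "y1 \<in> fst ` A" "y1 \<in> fst ` ?B" using one by auto
      then obtain z z' where z: "(y1,z) \<in> A" "(y1,z') \<in> ?B" by auto
      have "{y1} \<times> {z\<in>T. h z = d y1} \<subseteq> A"
        by (rule connected_subset_clopen[of ?E]) (use A fib[OF one(2)] one z AE in auto)
      then show False using z by auto
    qed
  qed
qed

text \<open>Passing from equal distances to equal displacement vectors: rotating the second
  component merges two clopen pieces only if they already meet.\<close>
lemma connected_gauge:
  fixes Y :: "'a::topological_space set" and T :: "('i \<Rightarrow> complex) set"
    and W :: "'a \<Rightarrow> complex" and e :: "('i \<Rightarrow> complex) \<Rightarrow> complex"
  assumes W: "continuous_on Y W" and e: "continuous_on T e"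
    and rot: "\<And>c z. cmod c = 1 \<Longrightarrow> z \<in> T \<Longrightarrow> (\<lambda>j. c * z j) \<in> T"
    and erot: "\<And>c z. cmod c = 1 \<Longrightarrow> z \<in> T \<Longrightarrow> e (\<lambda>j. c * z j) = c * e z"
    and con: "connected {(y,z). y \<in> Y \<and> z \<in> T \<and> cmod (e z) = cmod (W y)}" (is "connected ?F")
  shows "connected {(y,z). y \<in> Y \<and> z \<in> T \<and> e z = W y}" (is "connected ?E")
proof -
  let ?C = "sphere 0 1 :: complex set"
  let ?r = "\<lambda>c z. (\<lambda>j. c * z j) :: 'i \<Rightarrow> complex"
  have C: "compact ?C" "connected ?C" by (auto intro: connected_sphere)
  have Ecl: "closedin (top_of_set (Y \<times> T)) ?E"
  proof -
    have "continuous_on (Y \<times> T) (\<lambda>p. e (snd p) - W (fst p))"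
      by (intro continuous_intros continuous_on_compose2[OF e] continuous_on_compose2[OF W]) auto
    then have "closedin (top_of_set (Y \<times> T)) ((Y \<times> T) \<inter> (\<lambda>p. e (snd p) - W (fst p)) -` {0})"
      by (rule continuous_closedin_preimage) simp
    moreover have "(Y \<times> T) \<inter> (\<lambda>p. e (snd p) - W (fst p)) -` {0} = ?E" by auto
    ultimately show ?thesis by simp
  qed
  \<comment> \<open>Over \<open>?F\<close> only the lengths agree, so \<open>sat A\<close> collects
    the pairs that some rotation carries into \<open>A\<close>. The saturations of two complementary
    clopen pieces turn out to be closed, disjoint and to cover \<open>?F\<close>, against its
    connectedness.\<close>
  define sat where "sat A = {(y,z). (y,z) \<in> ?F \<and> (\<exists>c\<in>?C. (y, ?r c z) \<in> A)}" for A
  have satcl: "closedin (top_of_set ?F) (sat A)" if "closedin (top_of_set ?E) A" for A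
  proof -
    let ?g = "\<lambda>p. (fst (fst p), ?r (snd p) (snd (fst p)))"
    have AYT: "closedin (top_of_set (Y \<times> T)) A" by (rule closedin_trans[OF that Ecl])
    have "continuous_on (?F \<times> ?C) (\<lambda>p. snd (fst p) j)" for j
      by (rule continuous_on_product_then_coordinatewise) (intro continuous_on_fst continuous_on_snd continuous_on_id)
    then have "continuous_on (?F \<times> ?C) (\<lambda>p. ?r (snd p) (snd (fst p)))"
      by (intro continuous_on_coordinatewise_then_product continuous_on_mult continuous_on_snd continuous_on_id)
    then have co: "continuous_on (?F \<times> ?C) ?g"
      by (intro continuous_on_Pair continuous_on_fst continuous_on_id)
    have im: "?g \<in> (?F \<times> ?C) \<rightarrow> (Y \<times> T)" using rot by fastforce
    have "closedin (top_of_set (?F \<times> ?C)) ((?F \<times> ?C) \<inter> ?g -` A)"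
      by (rule continuous_closedin_preimage_gen[OF co im AYT])
    then have "closedin (top_of_set ?F) (fst ` ((?F \<times> ?C) \<inter> ?g -` A))"
      by (rule closedin_fst_image_compact[OF C(1)])
    moreover have "fst ` ((?F \<times> ?C) \<inter> ?g -` A) = sat A"
      by (force simp: sat_def image_iff)
    ultimately show ?thesis by simp
  qed
  have "A = {} \<or> A = ?E" if A: "openin (top_of_set ?E) A" "closedin (top_of_set ?E) A" for A
  proof (rule ccontr)
    let ?B = "?E - A"
    have AE: "A \<subseteq> ?E" using A openin_imp_subset by blast
    have B: "closedin (top_of_set ?E) ?B"
      using A closedin_top_of_set_compl by blast
    assume "\<not> (A = {} \<or> A = ?E)"
    then have ne: "A \<noteq> {}" "?B \<noteq> {}" using AE by auto
    have subs: "S \<subseteq> sat S" if "S \<subseteq> ?E" for S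
    proof
      fix p assume p: "p \<in> S"
      obtain y z where yz: "p = (y,z)" by (cases p)
      have "(y, ?r 1 z) \<in> S" "(y,z) \<in> ?F" using p yz that by auto
      moreover have "(1::complex) \<in> ?C" by simp
      ultimately show "p \<in> sat S" unfolding sat_def yz by blast
    qed
    have cov: "?F \<subseteq> sat A \<union> sat ?B"
    proof
      fix p assume "p \<in> ?F"
      then obtain y z where p: "p = (y,z)" and F: "(y,z) \<in> ?F" and yz: "y \<in> Y" "z \<in> T" "cmod (e z) = cmod (W y)" by auto
      obtain c where c: "cmod c = 1" "c * e z = W y"
      proof (cases "W y = 0")
        case True then show ?thesis using that[of 1] yz by auto
      next
        case False
        then have "e z \<noteq> 0" using yz by auto
        then show ?thesis using that[of "W y / e z"] yz False by (simp add: norm_divide)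
      qed
      then have "(y, ?r c z) \<in> ?E" using rot erot yz by auto
      then have "(y, ?r c z) \<in> A \<or> (y, ?r c z) \<in> ?B" by blast
      moreover have "c \<in> ?C" using c by simp
      ultimately show "p \<in> sat A \<union> sat ?B" unfolding sat_def p using F by blast
    qed
    have disj: "sat A \<inter> sat ?B = {}"
    proof (rule ccontr)
      assume "sat A \<inter> sat ?B \<noteq> {}"
      then obtain y z where sat: "(y,z) \<in> sat A" "(y,z) \<in> sat ?B" by auto
      have F: "(y,z) \<in> ?F" using sat(1) by (simp add: sat_def)
      obtain c where c1: "cmod c = 1" and A': "(y, ?r c z) \<in> A"
        using sat(1) by (auto simp: sat_def)
      obtain c' where c2: "cmod c' = 1" and B': "(y, ?r c' z) \<in> ?B"
        using sat(2) by (auto simp: sat_def)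
      note c = c1 c2
      have yz: "y \<in> Y" "z \<in> T" using F by auto
      have eq: "c * e z = W y" "c' * e z = W y"
        using A' B' AE erot[OF c(1) yz(2)] erot[OF c(2) yz(2)] by auto
      \<comment> \<open>The rotation taking \<open>e z\<close> to \<open>W y\<close> is unique
        unless \<open>e z = 0\<close>. In that case the whole circle of rotations of
        \<open>z\<close> lies in \<open>?E\<close> and is connected, so it cannot meet both
        pieces.\<close>
      show False
      proof (cases "e z = 0")
        case False
        then have "c = c'" using eq by (metis mult_right_cancel)
        then show False using A' B' by blast
      next
        case True
        have "continuous_on ?C (\<lambda>c. (y, ?r c z))"
          by (intro continuous_on_Pair continuous_on_coordinatewise_then_product continuous_intros)
        then have "connected ((\<lambda>c. (y, ?r c z)) ` ?C)"
          using C(2) by (rule connected_continuous_image)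
        moreover have "(\<lambda>c. (y, ?r c z)) ` ?C \<subseteq> ?E"
          using yz rot erot True eq by auto
        moreover have "(y, ?r c z) \<in> (\<lambda>c. (y, ?r c z)) ` ?C" using c1 by simp
        ultimately have "(\<lambda>c. (y, ?r c z)) ` ?C \<subseteq> A"
          using A' by (intro connected_subset_clopen[OF A]) blast+
        moreover have "(y, ?r c' z) \<in> (\<lambda>c. (y, ?r c z)) ` ?C" using c2 by simp
        ultimately show False using B' by blast
      qed
    qed
    have "sat A \<subseteq> ?F" "sat ?B \<subseteq> ?F" unfolding sat_def by auto
    moreover have "sat A \<noteq> {}" "sat ?B \<noteq> {}" using subs[of A] subs[of ?B] ne AE by auto
    ultimately show False
      using con satcl[OF A(2)] satcl[OF B] cov disj unfolding connected_closedin by blast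
  qed
  then show ?thesis unfolding connected_clopen by blast
qed

section \<open>Extrema of the end-to-end distance\<close>

definition linkvecs :: "nat \<Rightarrow> (nat \<Rightarrow> real) \<Rightarrow> (nat \<Rightarrow> complex) set" where
  "linkvecs m l = {z. (\<forall>j<m. cmod (z j) = l j) \<and> (\<forall>j\<ge>m. z j = 0)}"

text \<open>Rotating one summand \<open>z\<close> of a total \<open>w\<close> by the angle
  \<open>t\<close> gives \<open>w + z * (cis t - 1)\<close>. The \<open>sin t\<close> term carries
  the first-order change, the \<open>1 - cos t\<close> term the second-order one.\<close>

lemma norm_rotate_one:
  "(cmod (w + z * (cis t - 1)))\<^sup>2 =
     (cmod w)\<^sup>2 + 2 * (((cmod z)\<^sup>2 - Re (cnj w * z)) * (1 - cos t) - Im (cnj w * z) * sin t)"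
proof -
  obtain a b c d where w: "w = Complex a b" and z: "z = Complex c d" by (metis complex.exhaust)
  define s k where "s = sin t" and "k = cos t"
  have sk: "s^2 = 1 - k^2" by (simp add: s_def k_def sin_squared_eq)
  \<comment> \<open>A purely polynomial identity: the last summand is the multiple of
    \<open>s^2 + k^2 - 1\<close> by which the rest of it would fail.\<close>
  have "(a + (c * (k - 1) - d * s))\<^sup>2 + (b + (c * s + d * (k - 1)))\<^sup>2 =
    a\<^sup>2 + b\<^sup>2 + 2 * ((c\<^sup>2 + d\<^sup>2 - (a * c + b * d)) * (1 - k) - (a * d - b * c) * s)
    + (c^2 + d^2) * (s^2 - (1 - k^2))"
    by (simp add: power2_eq_square algebra_simps)
  then show ?thesis
    unfolding w z cmod_power2 using sk by (simp add: s_def k_def)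
qed

text \<open>The derivative at 0 is \<open>- B\<close>, so a local minimum there kills
  \<open>B\<close>; afterwards a single nonzero angle decides the sign of \<open>C\<close>.\<close>

lemma trig_form_nonneg:
  fixes B C :: real
  assumes "e > 0" and "\<And>t. \<bar>t\<bar> \<le> e \<Longrightarrow> 0 \<le> C * (1 - cos t) - B * sin t"
  shows "B = 0" "C \<ge> 0"
proof -
  let ?f = "\<lambda>t. C * (1 - cos t) - B * sin t"
  have "DERIV ?f 0 :> - B" by (auto intro!: derivative_eq_intros)
  moreover have "\<forall>t. \<bar>0 - t\<bar> < e \<longrightarrow> ?f 0 \<le> ?f t" using assms(2) by simp
  ultimately show B: "B = 0" using DERIV_local_min[of ?f "- B" 0 e] assms(1) by simp
  have "cos (min e 1) < 1"
    using cos_monotone_0_pi[of 0 "min e 1"] assms(1) pi_gt3 by simp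
  moreover have "0 \<le> C * (1 - cos (min e 1))" using assms(2)[of "min e 1"] assms(1) B by simp
  ultimately show "C \<ge> 0" by (simp add: zero_le_mult_iff)
qed

lemma rotate_one_local_min:
  assumes "e > 0" and "\<And>t. \<bar>t\<bar> \<le> e \<Longrightarrow> cmod w \<le> cmod (w + z * (cis t - 1))"
  shows "Im (cnj w * z) = 0"
proof -
  have "0 \<le> ((cmod z)\<^sup>2 - Re (cnj w * z)) * (1 - cos t) - Im (cnj w * z) * sin t" if "\<bar>t\<bar> \<le> e" for t
    using power_mono[OF assms(2)[OF that] norm_ge_zero, of 2] norm_rotate_one[of w z t] by simp
  then show ?thesis by (rule trig_form_nonneg[OF assms(1)])
qed

text \<open>Besides alignment, the second-order term shows that a nonzero \<open>z\<close> cannot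
  point against \<open>w\<close>, and that \<open>w\<close> is then itself nonzero.\<close>

lemma rotate_one_local_max:
  assumes "e > 0" and "\<And>t. \<bar>t\<bar> \<le> e \<Longrightarrow> cmod (w + z * (cis t - 1)) \<le> cmod w"
  shows "Im (cnj w * z) = 0" "Re (cnj w * z) \<ge> (cmod z)\<^sup>2"
proof -
  have "0 \<le> (Re (cnj w * z) - (cmod z)\<^sup>2) * (1 - cos t) - (- Im (cnj w * z)) * sin t" if "\<bar>t\<bar> \<le> e" for t
  proof -
    have flip: "(X - N) * q - (- I) * s = - ((N - X) * q - I * s)" for X N q I s :: real
      by (simp add: algebra_simps)
    define Y where "Y = ((cmod z)\<^sup>2 - Re (cnj w * z)) * (1 - cos t) - Im (cnj w * z) * sin t"
    have "(cmod (w + z * (cis t - 1)))\<^sup>2 \<le> (cmod w)\<^sup>2"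
      using power_mono[OF assms(2)[OF that] norm_ge_zero] .
    then have "Y \<le> 0" unfolding norm_rotate_one Y_def[symmetric] by simp
    then show ?thesis unfolding flip Y_def by linarith
  qed
  from trig_form_nonneg[OF assms(1) this]
  show "Im (cnj w * z) = 0" "Re (cnj w * z) \<ge> (cmod z)\<^sup>2" by simp_all
qed

lemma sum_rotate_one:
  fixes z :: "nat \<Rightarrow> complex"
  assumes "j < m"
  shows "(\<Sum>i<m. z i * cis (if i = j then t else 0)) = (\<Sum>i<m. z i) + z j * (cis t - 1)"
proof -
  have "(\<Sum>i<m. z i * cis (if i = j then t else 0)) = (\<Sum>i<m. z i + (if i = j then z j * (cis t - 1) else 0))"
    by (rule sum.cong) (auto simp: algebra_simps)
  then show ?thesis using assms by (simp add: sum.distrib)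
qed

lemma Re_eq_norm_if_Im_zero:
  assumes "Im (cnj w * z) = 0"
  shows "\<bar>Re (cnj w * z)\<bar> = cmod w * cmod z"
  using assms by (metis abs_norm_cancel cmod_eq_Re complex_mod_cnj norm_mult)

lemma cnj_mult_self: "cnj w * w = of_real (cmod w * cmod w)"
  by (metis complex_norm_square mult.commute of_real_power power2_eq_square)

text \<open>Maximality against rotating a single edge already makes every edge point along the
  total. Its length is then the sum of all edge lengths, the bound given by the triangle
  inequality.\<close>

lemma local_max_is_global:
  assumes pos: "\<And>j. j < m \<Longrightarrow> l j > 0" and z: "z \<in> linkvecs m l" "z' \<in> linkvecs m l" and "e > 0"
    and loc: "\<And>\<alpha>. (\<And>j. \<bar>\<alpha> j\<bar> \<le> e) \<Longrightarrow> cmod (\<Sum>j<m. z j * cis (\<alpha> j)) \<le> cmod (\<Sum>j<m. z j)"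
  shows "cmod (\<Sum>j<m. z' j) \<le> cmod (\<Sum>j<m. z j)"
proof (cases "m = 0")
  case False
  let ?w = "\<Sum>j<m. z j"
  have l: "cmod (z j) = l j" "cmod (z' j) = l j" if "j < m" for j using z that by (auto simp: linkvecs_def)
  have one: "Im (cnj ?w * z j) = 0" "Re (cnj ?w * z j) \<ge> (l j)\<^sup>2" if "j < m" for j
  proof -
    have "cmod (?w + z j * (cis t - 1)) \<le> cmod ?w" if t: "\<bar>t\<bar> \<le> e" for t
      using loc[of "\<lambda>i. if i = j then t else 0"] t \<open>e > 0\<close> sum_rotate_one[OF \<open>j < m\<close>, of z t] by simp
    from rotate_one_local_max[OF \<open>e > 0\<close> this]
    show "Im (cnj ?w * z j) = 0" "Re (cnj ?w * z j) \<ge> (l j)\<^sup>2" using l[OF that] by auto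
  qed
  have Re: "Re (cnj ?w * z j) = cmod ?w * l j" if "j < m" for j
  proof -
    have "Re (cnj ?w * z j) \<ge> 0" using one(2)[OF that] by (meson order_trans zero_le_power2)
    then show ?thesis using Re_eq_norm_if_Im_zero[OF one(1)[OF that]] l[OF that] by simp
  qed
  \<comment> \<open>A total of 0 would turn the second-order bound at edge 0 into
    \<open>l 0 = 0\<close>.\<close>
  have w: "cmod ?w > 0"
  proof (rule ccontr)
    assume "\<not> cmod ?w > 0"
    then have "(l 0)\<^sup>2 \<le> 0" using one(2)[of 0] False Re[of 0] by simp
    then show False using pos[of 0] False by simp
  qed
  have "cmod ?w * cmod ?w = Re (cnj ?w * ?w)"
    by (simp only: cnj_mult_self Re_complex_of_real)
  also have "\<dots> = (\<Sum>j<m. Re (cnj ?w * z j))" by (simp only: sum_distrib_left Re_sum)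
  also have "\<dots> = (\<Sum>j<m. cmod ?w * l j)" by (rule sum.cong) (use Re in auto)
  also have "\<dots> = cmod ?w * (\<Sum>j<m. l j)" by (simp add: sum_distrib_left)
  finally have "cmod ?w = (\<Sum>j<m. l j)" using w by simp
  moreover have "cmod (\<Sum>j<m. z' j) \<le> (\<Sum>j<m. l j)"
    by (rule sum_norm_le) (use l in auto)
  ultimately show ?thesis by simp
qed simp

text \<open>At a local minimum this rules out two edges that both point along the displacement: bending
  them in opposite directions keeps its direction and shortens it.\<close>
lemma bend_two:
  assumes r: "r > 0" and l: "0 < a" "a \<le> b" and "e > 0"
  obtains \<alpha> \<beta> where "\<bar>\<alpha>\<bar> \<le> e" "\<bar>\<beta>\<bar> \<le> e"
    "cmod (of_real r + of_real a * (cis \<alpha> - 1) + of_real b * (cis \<beta> - 1)) < r"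
proof -
  \<comment> \<open>The bound \<open>r / (a + b)\<close> keeps the shortening at most
    \<open>r\<close>, so that the new total does not pass through 0 and grow on the other
    side.\<close>
  define t where "t = min (min e 1) (r / (a + b))"
  have t: "0 < t" "t \<le> e" "t \<le> 1" "t \<le> r / (a + b)"
    using assms by (auto simp: t_def)
  \<comment> \<open>Chosen so that \<open>b * sin s = a * sin t\<close>: the edges turn by
    \<open>t\<close> and \<open>- s\<close>, and their transverse displacements cancel. Since
    \<open>a \<le> b\<close>, this angle is no larger than \<open>t\<close>.\<close>
  define s where "s = arcsin (a * sin t / b)"
  have t2: "t \<le> pi / 2" using t pi_gt3 by linarith
  have sin0: "0 \<le> sin t" "sin t \<le> 1" using t pi_gt3 by (auto intro: sin_ge_zero)
  have q: "0 \<le> a * sin t / b" "a * sin t / b \<le> sin t"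
    using l sin0 by (auto simp: field_simps mult_right_mono)
  then have q1: "-1 \<le> a * sin t / b" "a * sin t / b \<le> 1" using sin0 by linarith+
  have s0: "0 \<le> s" using q q1 arcsin_le_arcsin[of 0 "a * sin t / b"] by (simp add: s_def)
  have "s \<le> arcsin (sin t)" unfolding s_def using q q1 sin0 by (intro arcsin_le_arcsin) auto
  also have "arcsin (sin t) = t" using t t2 by (intro arcsin_sin) auto
  finally have st: "s \<le> t" .
  have sins: "b * sin s = a * sin t" using q1 l by (simp add: s_def)
  define \<rho> where "\<rho> = a * (1 - cos t) + b * (1 - cos s)"
  have cosb: "1 - cos x \<le> x / 2" if "0 \<le> x" "x \<le> 1" for x :: real
  proof -
    have "1 - cos x = 2 * (sin (x / 2))\<^sup>2" using cos_double_sin[of "x / 2"] by simp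
    also have "\<dots> \<le> 2 * (x / 2)\<^sup>2"
      using that pi_gt3 sin_x_le_x[of "x / 2"] by (intro mult_left_mono power_mono sin_ge_zero) auto
    also have "\<dots> = x\<^sup>2 / 2" by (simp add: power2_eq_square)
    also have "\<dots> \<le> x / 2" using that by (simp add: power2_eq_square mult_left_le)
    finally show ?thesis .
  qed
  have "cos t < 1" using cos_monotone_0_pi[of 0 t] t pi_gt3 by simp
  then have "\<rho> > 0" using l by (auto simp: \<rho>_def intro!: add_pos_nonneg)
  moreover have "\<rho> \<le> a * t + b * t"
  proof -
    have "1 - cos t \<le> t" "1 - cos s \<le> t" using cosb[of t] cosb[of s] t s0 st by auto
    then show ?thesis unfolding \<rho>_def using l by (intro add_mono mult_left_mono) auto
  qed
  moreover have "a * t + b * t \<le> r" using t(4) l by (simp add: field_simps)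
  ultimately have \<rho>: "0 < \<rho>" "\<rho> \<le> r" by auto
  have "of_real r + of_real a * (cis t - 1) + of_real b * (cis (- s) - 1) = complex_of_real (r - \<rho>)"
    using sins by (simp add: complex_eq_iff \<rho>_def algebra_simps)
  moreover have "cmod (complex_of_real (r - \<rho>)) < r" using \<rho> by (simp only: norm_of_real)
  ultimately have "cmod (of_real r + of_real a * (cis t - 1) + of_real b * (cis (- s) - 1)) < r"
    by (simp only:)
  then show thesis using that[of t "- s"] t s0 st by auto
qed

text \<open>At a nonzero local minimum all edges are parallel to the total and exactly one points
  along it. The length of the total is then one edge length minus all the others, a lower bound for
  every configuration by the reverse triangle inequality. A total of 0 is minimal anyway.\<close>

lemma local_min_is_global:
  assumes pos: "\<And>j. j < m \<Longrightarrow> l j > 0" and z: "z \<in> linkvecs m l" "z' \<in> linkvecs m l" and "e > 0"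
    and loc: "\<And>\<alpha>. (\<And>j. \<bar>\<alpha> j\<bar> \<le> e) \<Longrightarrow> cmod (\<Sum>j<m. z j) \<le> cmod (\<Sum>j<m. z j * cis (\<alpha> j))"
  shows "cmod (\<Sum>j<m. z j) \<le> cmod (\<Sum>j<m. z' j)"
proof (cases "(\<Sum>j<m. z j) = 0")
  case False
  let ?w = "\<Sum>j<m. z j"
  have l: "cmod (z j) = l j" "cmod (z' j) = l j" if "j < m" for j using z that by (auto simp: linkvecs_def)
  have w: "cmod ?w > 0" using False by simp
  have Im: "Im (cnj ?w * z j) = 0" if "j < m" for j
  proof (rule rotate_one_local_min[OF \<open>e > 0\<close>])
    fix t :: real assume t: "\<bar>t\<bar> \<le> e"
    show "cmod ?w \<le> cmod (?w + z j * (cis t - 1))"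
      using loc[of "\<lambda>i. if i = j then t else 0"] t \<open>e > 0\<close> sum_rotate_one[OF \<open>j < m\<close>, of z t] by simp
  qed
  \<comment> \<open>Signed lengths of the edges in the direction of the total; they add up to its
    norm.\<close>
  define x where "x j = Re (cnj ?w * z j) / cmod ?w" for j
  have zx: "z j = of_real (x j) * sgn ?w" if "j < m" for j
  proof -
    have "cnj ?w * z j = of_real (x j * cmod ?w)"
      using Im[OF that] w by (simp add: complex_eq_iff x_def)
    also have "\<dots> = cnj ?w * (of_real (x j) * sgn ?w)"
      using cnj_mult_self[of ?w] w by (simp add: sgn_eq field_simps)
    finally show ?thesis using False by (metis complex_cnj_zero_iff mult_left_cancel)
  qed
  have ax: "\<bar>x j\<bar> = l j" if "j < m" for j
    using zx[OF that] l(1)[OF that] False by (metis norm_mult norm_of_real norm_sgn mult.right_neutral)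
  have sx: "cmod ?w = (\<Sum>j<m. x j)"
  proof -
    have "of_real (cmod ?w) * sgn ?w = ?w" using w by (simp add: sgn_eq)
    also have "\<dots> = (\<Sum>j<m. of_real (x j) * sgn ?w)" by (rule sum.cong) (use zx in auto)
    also have "\<dots> = of_real (\<Sum>j<m. x j) * sgn ?w" by (simp add: sum_distrib_right)
    finally have "complex_of_real (cmod ?w) = of_real (\<Sum>j<m. x j)"
      using False by (metis mult_right_cancel sgn_zero_iff)
    then show ?thesis by (simp only: of_real_eq_iff)
  qed
  \<comment> \<open>The order \<open>x j \<le> x k\<close> is what \<open>bend_two\<close> needs;
    applying the fact to both orders later removes it.\<close>
  have uniq: False if jk: "j < m" "k < m" "j \<noteq> k" "x j > 0" "x k > 0" "x j \<le> x k" for j k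
  proof -
    obtain \<alpha> \<beta> where ab: "\<bar>\<alpha>\<bar> \<le> e" "\<bar>\<beta>\<bar> \<le> e"
      "cmod (of_real (cmod ?w) + of_real (x j) * (cis \<alpha> - 1) + of_real (x k) * (cis \<beta> - 1)) < cmod ?w"
      using bend_two[OF w jk(4,6) \<open>e > 0\<close>] .
    define \<gamma> where "\<gamma> i = (if i = j then \<alpha> else if i = k then \<beta> else 0)" for i
    have "(\<Sum>i<m. z i * cis (\<gamma> i)) = (\<Sum>i<m. z i + (if i = j then z j * (cis \<alpha> - 1) else 0)
              + (if i = k then z k * (cis \<beta> - 1) else 0))"
      by (rule sum.cong) (use jk in \<open>auto simp: \<gamma>_def algebra_simps\<close>)
    also have "\<dots> = ?w + z j * (cis \<alpha> - 1) + z k * (cis \<beta> - 1)"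
      using jk by (simp add: sum.distrib)
    also have "\<dots> = (of_real (cmod ?w) + of_real (x j) * (cis \<alpha> - 1) + of_real (x k) * (cis \<beta> - 1)) * sgn ?w"
    proof -
      have "?w = of_real (cmod ?w) * sgn ?w" using w by (simp add: sgn_eq)
      moreover have "(r + p * c + q * d) * s = r * s + (p * s) * c + (q * s) * d" for r p q c d s :: complex
        by (simp add: algebra_simps)
      ultimately show ?thesis using zx[OF jk(1)] zx[OF jk(2)] by (simp only:)
    qed
    finally have "cmod (\<Sum>i<m. z i * cis (\<gamma> i)) < cmod ?w"
      using ab(3) False by (simp add: norm_mult norm_sgn)
    moreover have "cmod ?w \<le> cmod (\<Sum>i<m. z i * cis (\<gamma> i))"
      by (rule loc) (use ab \<open>e > 0\<close> in \<open>auto simp: \<gamma>_def\<close>)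
    ultimately show False by simp
  qed
  have "\<exists>j<m. x j > 0"
  proof (rule ccontr)
    assume "\<not> ?thesis"
    then have "(\<Sum>j<m. x j) \<le> 0" by (intro sum_nonpos) (meson not_less lessThan_iff)
    then show False using sx w by simp
  qed
  then obtain j where j: "j < m" "x j > 0" by blast
  have others: "x k = - l k" if "k < m" "k \<noteq> j" for k
  proof -
    have "\<not> x k > 0" using uniq[of j k] uniq[of k j] j that by (metis linorder_le_cases)
    then show ?thesis using ax[OF that(1)] by linarith
  qed
  have split: "(\<Sum>i<m. f i) = f j + (\<Sum>i\<in>{..<m} - {j}. f i)" for f :: "nat \<Rightarrow> 'a::comm_monoid_add"
    using j by (intro sum.remove) auto
  have "cmod ?w = l j - (\<Sum>i\<in>{..<m} - {j}. l i)"
    using split[of x] sx ax[OF j(1)] j others by (simp add: sum_negf)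
  also have "\<dots> \<le> cmod (z' j) - cmod (\<Sum>i\<in>{..<m} - {j}. z' i)"
  proof -
    have "cmod (\<Sum>i\<in>{..<m} - {j}. z' i) \<le> (\<Sum>i\<in>{..<m} - {j}. l i)"
      by (rule sum_norm_le) (use l in auto)
    then show ?thesis using l(2)[OF j(1)] by linarith
  qed
  also have "\<dots> \<le> cmod (\<Sum>i<m. z' i)" unfolding split[of z'] by (rule norm_diff_ineq)
  finally show ?thesis .
qed simp

section \<open>Spaces of edge vectors as products, and openness of the end-to-end distance\<close>

lemma PiE_UNIV_fun: "PiE UNIV S = {z. \<forall>j. z j \<in> S j}"
  by (auto simp: PiE_iff)

lemma connected_fun_box:
  fixes S :: "'i \<Rightarrow> 'b::topological_space set"
  assumes "\<And>j. connected (S j)"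
  shows "connected {z. \<forall>j. z j \<in> S j}"
proof -
  have "connectedin (product_topology (\<lambda>i. euclidean) UNIV) (PiE UNIV S)"
    using assms by (auto simp: connectedin_PiE)
  then show ?thesis by (simp add: euclidean_product_topology PiE_UNIV_fun)
qed

lemma compact_fun_box:
  fixes S :: "'i \<Rightarrow> 'b::topological_space set"
  assumes "\<And>j. compact (S j)"
  shows "compact {z. \<forall>j. z j \<in> S j}"
proof -
  have "compactin (product_topology (\<lambda>i. euclidean) UNIV) (PiE UNIV S)"
    using assms by (auto simp: compactin_PiE)
  then show ?thesis by (simp add: euclidean_product_topology PiE_UNIV_fun)
qed

lemma continuous_on_coord [continuous_intros]:
  "continuous_on A (\<lambda>z :: 'i \<Rightarrow> 'b::topological_space. z j)"
  by (rule continuous_on_product_then_coordinatewise) (rule continuous_on_id)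

lemma linkvecs_box: "linkvecs m l = {z. \<forall>j. z j \<in> (if j < m then sphere 0 (l j) else {0})}"
proof -
  have "(x \<in> (if j < m then sphere 0 (l j) else {0})) \<longleftrightarrow>
      (j < m \<longrightarrow> cmod x = l j) \<and> (m \<le> j \<longrightarrow> x = 0)" for x :: complex and j
    by auto
  then show ?thesis unfolding linkvecs_def by (simp only:) blast
qed

lemma connected_linkvecs: "connected (linkvecs m l)"
  unfolding linkvecs_box by (rule connected_fun_box) (auto intro: connected_sphere)

lemma compact_linkvecs: "compact (linkvecs m l)"
  unfolding linkvecs_box by (rule compact_fun_box) auto

lemma linkvecs_rotate: "cmod c = 1 \<Longrightarrow> z \<in> linkvecs m l \<Longrightarrow> (\<lambda>j. c * z j) \<in> linkvecs m l"
  by (auto simp: linkvecs_def norm_mult)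

text \<open>A basic neighbourhood in the product topology constrains only finitely many coordinates,
  so one positive angle serves for all of them.\<close>

lemma small_rotations_in_open:
  fixes z :: "nat \<Rightarrow> complex"
  assumes U: "open U" "z \<in> U"
  obtains e where "e > 0" "\<And>\<alpha>. (\<And>j. \<bar>\<alpha> j\<bar> \<le> e) \<Longrightarrow> (\<lambda>j. z j * cis (\<alpha> j)) \<in> U"
proof -
  let ?g = "\<lambda>\<alpha> :: nat \<Rightarrow> real. (\<lambda>j. z j * cis (\<alpha> j))"
  have "continuous_on UNIV ?g"
    by (intro continuous_on_coordinatewise_then_product continuous_intros)
  then have "open (?g -` U)" using U(1) by (simp add: continuous_on_open_vimage)
  moreover have "(\<lambda>j. 0) \<in> ?g -` U" using U(2) by simp
  ultimately obtain X where X: "(\<lambda>j. 0) \<in> PiE UNIV X" "\<And>i. open (X i)" "finite {i. X i \<noteq> UNIV}"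
      "PiE UNIV X \<subseteq> ?g -` U"
    unfolding open_fun_def using product_topology_open_contains_basis[of "\<lambda>_. euclidean" UNIV "?g -` U" "\<lambda>_. 0"]
    by (auto simp del: vimage_eq)
  have "\<exists>e>0. \<forall>x. \<bar>x\<bar> \<le> e \<longrightarrow> x \<in> X i" for i
  proof -
    have "0 \<in> X i" using X(1) by (auto simp: PiE_iff)
    then obtain e where "e > 0" "cball 0 e \<subseteq> X i" using X(2) open_contains_cball by blast
    then show ?thesis by (auto simp: subset_iff)
  qed
  then obtain E where E: "\<And>i. E i > 0" "\<And>i x. \<bar>x\<bar> \<le> E i \<Longrightarrow> x \<in> X i" by metis
  \<comment> \<open>The extra 1 provides a minimum also when no coordinate is constrained.\<close>
  define e where "e = Min (insert 1 (E ` {i. X i \<noteq> UNIV}))"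
  have "e > 0" unfolding e_def using X(3) E(1) by (subst Min_gr_iff) auto
  moreover have "(\<lambda>j. z j * cis (\<alpha> j)) \<in> U" if "\<And>j. \<bar>\<alpha> j\<bar> \<le> e" for \<alpha>
  proof -
    have "\<alpha> i \<in> X i" for i
    proof (cases "X i = UNIV")
      case False
      then have "e \<le> E i" unfolding e_def using X(3) by (intro Min_le) auto
      then show ?thesis using that E(2) order_trans by blast
    qed simp
    then show ?thesis using X(4) by (auto simp: PiE_iff)
  qed
  ultimately show thesis using that by blast
qed

text \<open>The small rotations form a connected box, so the lengths they produce fill an interval
  containing the length of \<open>z\<close>. If this interval does not extend to one side,
  \<open>z\<close> is a local extremum, hence a global one, and no attainable length lies beyond it
  on that side.\<close>

lemma end_distance_open:
  assumes pos: "\<And>j. j < m \<Longrightarrow> l j > 0" and z: "z \<in> linkvecs m l" and U: "open U" "z \<in> U"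
  shows "\<exists>\<delta>>0. \<forall>t\<in>(\<lambda>z. cmod (\<Sum>j<m. z j)) ` linkvecs m l. \<bar>t - cmod (\<Sum>j<m. z j)\<bar> < \<delta> \<longrightarrow>
           (\<exists>z'\<in>linkvecs m l \<inter> U. cmod (\<Sum>j<m. z' j) = t)"
proof -
  let ?h = "\<lambda>z :: nat \<Rightarrow> complex. cmod (\<Sum>j<m. z j)"
  obtain e where e: "e > 0" "\<And>\<alpha>. (\<And>j. \<bar>\<alpha> j\<bar> \<le> e) \<Longrightarrow> (\<lambda>j. z j * cis (\<alpha> j)) \<in> U"
    using small_rotations_in_open[OF U] by metis
  define B where "B = {\<alpha> :: nat \<Rightarrow> real. \<forall>j. \<alpha> j \<in> {-e..e}}"
  define g where "g = (\<lambda>\<alpha> :: nat \<Rightarrow> real. (\<lambda>j. z j * cis (\<alpha> j)))"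
  have gT: "g \<alpha> \<in> linkvecs m l \<inter> U" if "\<alpha> \<in> B" for \<alpha>
  proof
    have "\<bar>\<alpha> j\<bar> \<le> e" for j using that by (simp add: B_def abs_le_iff minus_le_iff)
    then show "g \<alpha> \<in> U" unfolding g_def by (rule e(2))
    show "g \<alpha> \<in> linkvecs m l" using z by (simp add: linkvecs_def g_def norm_mult)
  qed
  have "connected B" unfolding B_def by (rule connected_fun_box) simp
  moreover have "continuous_on B (\<lambda>\<alpha>. ?h (g \<alpha>))"
    unfolding g_def by (intro continuous_intros)
  ultimately have con: "connected ((\<lambda>\<alpha>. ?h (g \<alpha>)) ` B)" by (rule connected_continuous_image[rotated])
  have zB: "(\<lambda>_. 0) \<in> B" "g (\<lambda>_. 0) = z" using e(1) by (auto simp: B_def g_def)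
  have h0: "?h z \<in> (\<lambda>\<alpha>. ?h (g \<alpha>)) ` B" 
    using imageI[OF zB(1), of "\<lambda>\<alpha>. ?h (g \<alpha>)"] by (simp only: zB(2))
  have Babs: "\<alpha> \<in> B" if "\<And>j. \<bar>\<alpha> j\<bar> \<le> e" for \<alpha>
    using that by (simp add: B_def abs_le_iff minus_le_iff)
  have lo: "\<exists>d>0. \<forall>t\<in>?h ` linkvecs m l. ?h z - d < t \<longrightarrow> t \<le> ?h z \<longrightarrow> t \<in> (\<lambda>\<alpha>. ?h (g \<alpha>)) ` B"
  proof (cases "\<exists>\<alpha>\<in>B. ?h (g \<alpha>) < ?h z")
    case True
    then obtain \<alpha> where \<alpha>: "\<alpha> \<in> B" "?h (g \<alpha>) < ?h z" by blast
    have "t \<in> (\<lambda>\<alpha>. ?h (g \<alpha>)) ` B" if "?h (g \<alpha>) < t" "t \<le> ?h z" for t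
      using connectedD_interval[OF con imageI[OF \<alpha>(1)] h0] that by simp
    then show ?thesis using \<alpha>(2) by (intro exI[of _ "?h z - ?h (g \<alpha>)"]) auto
  next
    case False
    then have "?h z \<le> ?h z'" if "z' \<in> linkvecs m l" for z'
      using local_min_is_global[OF pos z that e(1)] Babs by (force simp: g_def not_less)
    then show ?thesis using h0 by (intro exI[of _ 1]) force
  qed
  have hi: "\<exists>d>0. \<forall>t\<in>?h ` linkvecs m l. t < ?h z + d \<longrightarrow> ?h z \<le> t \<longrightarrow> t \<in> (\<lambda>\<alpha>. ?h (g \<alpha>)) ` B"
  proof (cases "\<exists>\<alpha>\<in>B. ?h z < ?h (g \<alpha>)")
    case True
    then obtain \<alpha> where \<alpha>: "\<alpha> \<in> B" "?h z < ?h (g \<alpha>)" by blast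
    have "t \<in> (\<lambda>\<alpha>. ?h (g \<alpha>)) ` B" if "t < ?h (g \<alpha>)" "?h z \<le> t" for t
      using connectedD_interval[OF con h0 imageI[OF \<alpha>(1)]] that by simp
    then show ?thesis using \<alpha>(2) by (intro exI[of _ "?h (g \<alpha>) - ?h z"]) auto
  next
    case False
    then have "?h z' \<le> ?h z" if "z' \<in> linkvecs m l" for z'
      using local_max_is_global[OF pos z that e(1)] Babs by (force simp: g_def not_less)
    then show ?thesis using h0 by (intro exI[of _ 1]) force
  qed
  obtain d1 where d1: "d1 > 0" "\<forall>t\<in>?h ` linkvecs m l. ?h z - d1 < t \<longrightarrow> t \<le> ?h z \<longrightarrow> t \<in> (\<lambda>\<alpha>. ?h (g \<alpha>)) ` B"
    using lo by blast
  obtain d2 where d2: "d2 > 0" "\<forall>t\<in>?h ` linkvecs m l. t < ?h z + d2 \<longrightarrow> ?h z \<le> t \<longrightarrow> t \<in> (\<lambda>\<alpha>. ?h (g \<alpha>)) ` B"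
    using hi by blast
  show ?thesis
  proof (intro exI[of _ "min d1 d2"] conjI ballI impI)
    fix t assume t: "t \<in> ?h ` linkvecs m l" "\<bar>t - ?h z\<bar> < min d1 d2"
    then have t': "?h z - d1 < t" "t < ?h z + d2" by (auto simp: abs_less_iff)
    have "t \<in> (\<lambda>\<alpha>. ?h (g \<alpha>)) ` B"
    proof (cases "t \<le> ?h z")
      case True
      then show ?thesis by (rule d1(2)[rule_format, OF t(1) t'(1)])
    next
      case False
      then have "?h z \<le> t" by simp
      then show ?thesis by (rule d2(2)[rule_format, OF t(1) t'(2)])
    qed
    then obtain \<alpha> where \<alpha>: "t = ?h (g \<alpha>)" "\<alpha> \<in> B" by (rule imageE)
    then show "\<exists>z'\<in>linkvecs m l \<inter> U. ?h z' = t" 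
      by (intro bexI[of _ "g \<alpha>"] \<alpha>(1)[symmetric] gT[OF \<alpha>(2)])
  qed (use d1 d2 in auto)
qed

section \<open>The moduli space and its quotient topology\<close>

definition cls :: "'a topology \<Rightarrow> ('a \<Rightarrow> 'a \<Rightarrow> bool) \<Rightarrow> 'a \<Rightarrow> 'a set" where
  "cls X R x = {y \<in> topspace X. R x y}"

text \<open>Distinct classes are disjoint, so forming the union of a family of classes commutes with
  intersection. This makes the predicate inside \<open>quotient_topology\<close> a topology, which
  is needed before its open sets can be read off.\<close>

lemma quotient_topology_of_equiv:
  fixes X :: "'a topology" and R :: "'a \<Rightarrow> 'a \<Rightarrow> bool"
  assumes refl: "\<And>x. x \<in> topspace X \<Longrightarrow> R x x"
    and sym: "\<And>x y. R x y \<Longrightarrow> x \<in> topspace X \<Longrightarrow> y \<in> topspace X \<Longrightarrow> R y x"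
    and trans: "\<And>x y z. R x y \<Longrightarrow> R y z \<Longrightarrow> R x z"
  shows "openin (quotient_topology X R) U \<longleftrightarrow> U \<subseteq> cls X R ` topspace X \<and> openin X (\<Union>U)" (is ?op)
    and "topspace (quotient_topology X R) = cls X R ` topspace X" (is ?ts)
    and "quotient_map X (quotient_topology X R) (cls X R)" (is ?qm)
proof -
  let ?C = "cls X R ` topspace X"
  have eq: "cls X R a = cls X R x" if a: "a \<in> topspace X" "x \<in> cls X R a" for a x
  proof -
    have x: "R a x" "R x a" using that sym by (auto simp: cls_def)
    have "R a y \<longleftrightarrow> R x y" for y
      using trans[OF x(1), of y] trans[OF x(2), of y] by blast
    then show ?thesis by (simp add: cls_def)
  qed
  have disj: "c = c'" if "c \<in> ?C" "c' \<in> ?C" "x \<in> c" "x \<in> c'" for c c' x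
    using that eq by (elim imageE) metis
  have Int: "\<Union>(U \<inter> V) = \<Union>U \<inter> \<Union>V" if "U \<subseteq> ?C" "V \<subseteq> ?C" for U V
  proof
    show "\<Union>U \<inter> \<Union>V \<subseteq> \<Union>(U \<inter> V)"
    proof
      fix x assume "x \<in> \<Union>U \<inter> \<Union>V"
      then obtain c c' where "c \<in> U" "c' \<in> V" "x \<in> c" "x \<in> c'" by blast
      moreover from this have "c = c'" using disj that by blast
      ultimately show "x \<in> \<Union>(U \<inter> V)" by blast
    qed
  qed blast
  have "istopology (\<lambda>U. U \<subseteq> ?C \<and> openin X (\<Union>U))"
    unfolding istopology_def
  proof (intro conjI allI impI)
    fix S T assume "S \<subseteq> ?C \<and> openin X (\<Union>S)" "T \<subseteq> ?C \<and> openin X (\<Union>T)"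
    then show "S \<inter> T \<subseteq> ?C" "openin X (\<Union>(S \<inter> T))" using Int[of S T] by auto
  next
    fix K assume K: "\<forall>S\<in>K. S \<subseteq> ?C \<and> openin X (\<Union>S)"
    then show "\<Union>K \<subseteq> ?C" by blast
    have "\<Union>(\<Union>K) = \<Union>(Union ` K)" by blast
    then show "openin X (\<Union>(\<Union>K))" using K by auto
  qed
  then show op: "openin (quotient_topology X R) U \<longleftrightarrow> U \<subseteq> ?C \<and> openin X (\<Union>U)" for U
    unfolding quotient_topology_def cls_def[symmetric] by (simp add: topology_inverse')
  have UC: "\<Union>?C = topspace X" using refl by (auto simp: cls_def)
  show ts: ?ts
  proof
    show "topspace (quotient_topology X R) \<subseteq> ?C"
      using op[of "topspace (quotient_topology X R)"] by simp
    show "?C \<subseteq> topspace (quotient_topology X R)"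
      using op[of ?C] UC by (intro openin_subset) simp
  qed
  show ?qm
    unfolding quotient_map_def
  proof (intro conjI allI impI)
    show "?C = topspace (quotient_topology X R)" using ts by simp
    fix U assume "U \<subseteq> topspace (quotient_topology X R)"
    then have U: "U \<subseteq> ?C" using ts by simp
    have "{x. x \<in> topspace X \<and> cls X R x \<in> U} = \<Union>U"
    proof (intro set_eqI iffI)
      fix x assume "x \<in> {x. x \<in> topspace X \<and> cls X R x \<in> U}"
      then have "x \<in> cls X R x" "cls X R x \<in> U" using refl[of x] by (auto simp: cls_def)
      then show "x \<in> \<Union>U" by blast
    next
      fix x assume "x \<in> \<Union>U"
      then obtain c where c: "c \<in> U" "x \<in> c" by blast
      then have x: "x \<in> topspace X" using U by (auto simp: cls_def)
      then have "x \<in> cls X R x" using refl by (auto simp: cls_def)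
      then have "cls X R x = c" using disj[of "cls X R x" c x] c U x by blast
      then show "x \<in> {x. x \<in> topspace X \<and> cls X R x \<in> U}" using x c by simp
    qed
    then show "openin X {x. x \<in> topspace X \<and> cls X R x \<in> U} \<longleftrightarrow> openin (quotient_topology X R) U"
      using op U by simp
  qed
qed

section \<open>Isometry classes of configurations\<close>

lemma congr_refl: "congr L p p"
  unfolding congr_def by (rule exI[of _ 1], rule exI[of _ 0]) simp

lemma congr_sym:
  assumes "congr L p q" shows "congr L q p"
proof -
  obtain a b where ab: "cmod a = 1" "\<forall>x\<in>lverts L. q x = a * p x + b"
    using assms unfolding congr_def by blast
  then have "a \<noteq> 0" by auto
  then have "\<forall>x\<in>lverts L. p x = inverse a * q x + (- inverse a * b)"
    using ab(2) by (simp add: algebra_simps)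
  moreover have "cmod (inverse a) = 1" using ab(1) by (simp add: norm_inverse)
  ultimately show ?thesis unfolding congr_def by blast
qed

lemma congr_trans:
  assumes "congr L p q" "congr L q r" shows "congr L p r"
proof -
  obtain a b where ab: "cmod a = 1" "\<forall>x\<in>lverts L. q x = a * p x + b"
    using assms unfolding congr_def by blast
  obtain c d where cd: "cmod c = 1" "\<forall>x\<in>lverts L. r x = c * q x + d"
    using assms unfolding congr_def by blast
  have "\<forall>x\<in>lverts L. r x = (c * a) * p x + (c * b + d)" "cmod (c * a) = 1"
    using ab cd by (auto simp: norm_mult algebra_simps)
  then show ?thesis unfolding congr_def by blast
qed

lemma topspace_Mtop: "topspace (Mtop L) = cls (top_of_set (Cfg L)) (congr L) ` Cfg L"
  unfolding Mtop_def
  by (subst quotient_topology_of_equiv(2)) (auto intro: congr_refl congr_sym congr_trans)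

lemma quotient_map_Mtop:
  "quotient_map (top_of_set (Cfg L)) (Mtop L) (cls (top_of_set (Cfg L)) (congr L))"
  unfolding Mtop_def by (rule quotient_topology_of_equiv(3)) (auto intro: congr_refl congr_sym congr_trans)

text \<open>The class is a continuous image of the circle of rotations times the plane of
  translations; off the vertex set the value stays 0, as \<open>Cfg\<close> prescribes.\<close>

lemma connected_congr_class:
  assumes wf: "\<And>e. e \<in> ledges L \<Longrightarrow> lends L e \<subseteq> lverts L" and p: "p \<in> Cfg L"
  shows "connected {q \<in> Cfg L. congr L p q}"
proof -
  let ?g = "\<lambda>(a, b). \<lambda>x. if x \<in> lverts L then a * p x + b else 0"
  have "{q \<in> Cfg L. congr L p q} = ?g ` (sphere 0 1 \<times> UNIV)"
  proof (intro set_eqI iffI)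
    fix q assume "q \<in> {q \<in> Cfg L. congr L p q}"
    then obtain a b where "cmod a = 1" "\<forall>x\<in>lverts L. q x = a * p x + b" and q: "q \<in> Cfg L"
      unfolding congr_def by blast
    then have "q = ?g (a, b)" "(a, b) \<in> sphere 0 1 \<times> UNIV" by (auto simp: Cfg_def)
    then show "q \<in> ?g ` (sphere 0 1 \<times> UNIV)" by blast
  next
    fix q assume "q \<in> ?g ` (sphere 0 1 \<times> UNIV)"
    then obtain a b where a: "cmod a = 1" and q: "q = ?g (a, b)" by auto
    have "cmod (q x - q y) = llen L e" if e: "e \<in> ledges L" "lends L e = {x, y}" for e x y
    proof -
      have "x \<in> lverts L" "y \<in> lverts L" using wf[OF e(1)] e by auto
      then have "q x - q y = a * (p x - p y)" by (simp add: q algebra_simps)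
      then show ?thesis using p e a by (auto simp: Cfg_def norm_mult)
    qed
    then have "q \<in> Cfg L" by (auto simp: Cfg_def q)
    moreover have "congr L p q" unfolding congr_def using a q by auto
    ultimately show "q \<in> {q \<in> Cfg L. congr L p q}" by simp
  qed
  moreover have "connected (?g ` (sphere 0 1 \<times> UNIV))"
  proof (rule connected_continuous_image)
    have "continuous_on S (\<lambda>z. if x \<in> lverts L then fst z * p x + snd z else 0)" for S and x
      by (cases "x \<in> lverts L") (auto intro!: continuous_intros)
    then show "continuous_on (sphere 0 1 \<times> UNIV) ?g"
      unfolding case_prod_beta by (rule continuous_on_coordinatewise_then_product)
  qed (auto intro: connected_Times connected_sphere)
  ultimately show ?thesis by simp
qed

text \<open>Connected fibres are what allows connectedness to be pulled back along the quotient
  map.\<close>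

lemma Mtop_monotone:
  assumes wf: "\<And>e. e \<in> ledges L \<Longrightarrow> lends L e \<subseteq> lverts L"
  shows "monotone_map (top_of_set (Cfg L)) (Mtop L) (cls (top_of_set (Cfg L)) (congr L))"
  unfolding monotone_map_def
proof (intro conjI ballI)
  let ?q = "cls (top_of_set (Cfg L)) (congr L)"
  show "?q ` topspace (top_of_set (Cfg L)) \<subseteq> topspace (Mtop L)"
    by (simp add: topspace_Mtop)
  fix c assume "c \<in> topspace (Mtop L)"
  then obtain p where p: "p \<in> Cfg L" "c = ?q p" by (auto simp: topspace_Mtop)
  have "{x \<in> topspace (top_of_set (Cfg L)). ?q x = c} = {q \<in> Cfg L. congr L p q}"
  proof (intro set_eqI iffI)
    fix x assume x: "x \<in> {x \<in> topspace (top_of_set (Cfg L)). ?q x = c}"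
    then have "x \<in> ?q p" using congr_refl[of L x] p(2) by (simp add: cls_def) blast
    then show "x \<in> {q \<in> Cfg L. congr L p q}" by (simp add: cls_def)
  next
    fix x assume x: "x \<in> {q \<in> Cfg L. congr L p q}"
    have "congr L x y \<longleftrightarrow> congr L p y" for y
      using x congr_sym[of L p x] congr_trans[of L p x y] congr_trans[of L x p y] by blast
    then show "x \<in> {x \<in> topspace (top_of_set (Cfg L)). ?q x = c}"
      using x p(2) by (simp add: cls_def)
  qed
  then show "connectedin (top_of_set (Cfg L)) {x \<in> topspace (top_of_set (Cfg L)). ?q x = c}"
    using connected_congr_class[OF wf p(1)] by (auto simp: connectedin_subtopology)
qed

lemma connected_Mtop_iff:
  assumes wf: "\<And>e. e \<in> ledges L \<Longrightarrow> lends L e \<subseteq> lverts L"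
  shows "connected_space (Mtop L) \<longleftrightarrow> connected (Cfg L)"
proof -
  note qm = quotient_map_Mtop[of L]
  have "connected_space (Mtop L) \<longleftrightarrow> connected_space (top_of_set (Cfg L))"
    using connected_space_monotone_quotient_map_preimage[OF Mtop_monotone[OF wf] qm]
      connected_space_quotient_map_image[OF qm] by blast
  then show ?thesis by (simp add: connectedin_def[of euclidean, simplified])
qed

text \<open>The level in the moduli space is closed, because its preimage is a closed level in
  \<open>Cfg P\<close>. A closed connected set pulls back to a connected one along a monotone
  quotient map.\<close>

lemma nabla_level_connected:
  assumes wf: "\<And>e. e \<in> ledges P \<Longrightarrow> lends P e \<subseteq> lverts P" and uv: "u \<in> lverts P" "v \<in> lverts P"
    and x: "x \<in> nabla P u v"
  shows "connected {p \<in> Cfg P. cmod (p u - p v) = x}"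
proof -
  let ?X = "top_of_set (Cfg P)" and ?q = "cls (top_of_set (Cfg P)) (congr P)"
  let ?C = "{c \<in> topspace (Mtop P). \<exists>p\<in>c. cmod (p u - p v) = x}"
  note qm = quotient_map_Mtop[of P]
  have inv: "cmod (q u - q v) = cmod (p u - p v)" if pq: "congr P p q" for p q
  proof -
    obtain a b where "cmod a = 1" "\<forall>x\<in>lverts P. q x = a * p x + b"
      using pq unfolding congr_def by blast
    moreover from this have "q u - q v = a * (p u - p v)" using uv by (simp add: algebra_simps)
    ultimately show ?thesis by (simp add: norm_mult)
  qed
  have pre: "{p \<in> topspace ?X. ?q p \<in> ?C} = {p \<in> Cfg P. cmod (p u - p v) = x}"
  proof (intro set_eqI iffI)
    fix p assume "p \<in> {p \<in> topspace ?X. ?q p \<in> ?C}"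
    then obtain q where "p \<in> Cfg P" "q \<in> ?q p" "cmod (q u - q v) = x" by auto
    then show "p \<in> {p \<in> Cfg P. cmod (p u - p v) = x}" using inv[of p q] by (auto simp: cls_def)
  next
    fix p assume p: "p \<in> {p \<in> Cfg P. cmod (p u - p v) = x}"
    then have "p \<in> ?q p" by (simp add: cls_def congr_refl)
    then show "p \<in> {p \<in> topspace ?X. ?q p \<in> ?C}" using p by (auto simp: topspace_Mtop)
  qed
  have "closedin ?X {p \<in> Cfg P. cmod (p u - p v) = x}"
  proof -
    have "continuous_on (Cfg P) (\<lambda>p. cmod (p u - p v))"
      by (intro continuous_intros continuous_on_product_then_coordinatewise)
    then have "closedin ?X (Cfg P \<inter> (\<lambda>p. cmod (p u - p v)) -` {x})"
      by (rule continuous_closedin_preimage) simp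
    moreover have "Cfg P \<inter> (\<lambda>p. cmod (p u - p v)) -` {x} = {p \<in> Cfg P. cmod (p u - p v) = x}" by auto
    ultimately show ?thesis by simp
  qed
  moreover have "closedin ?X {p \<in> topspace ?X. ?q p \<in> ?C} \<longleftrightarrow> closedin (Mtop P) ?C"
    by (rule qm[unfolded quotient_map_closedin, THEN conjunct2, rule_format]) (rule Collect_subset)
  ultimately have "closedin (Mtop P) ?C" unfolding pre by simp
  moreover have "connectedin (Mtop P) ?C" using x by (simp add: nabla_def)
  ultimately have "connectedin ?X {p \<in> topspace ?X. ?q p \<in> ?C}"
    using connectedin_monotone_quotient_map_preimage[OF Mtop_monotone[OF wf] qm] by blast
  then show ?thesis unfolding pre by (simp add: connectedin_subtopology)
qed

section \<open>Fibres of the end-to-end distance\<close>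

text \<open>\<open>W\<close> is the displacement to be bridged: the difference of the terminal
  positions when a path is attached, and the base point itself in the study of the short edges of Q.
  The second alternative in \<open>lev\<close> covers paths with edges of length 0.\<close>

lemma connected_attach_vectors:
  fixes Y :: "'a::topological_space set" and W :: "'a \<Rightarrow> complex"
  assumes Y: "connected Y" and W: "continuous_on Y W"
    and sub: "(\<lambda>y. cmod (W y)) ` Y \<subseteq> (\<lambda>z. cmod (\<Sum>j<m. z j)) ` linkvecs m l"
    and lev: "(\<forall>j<m. l j > 0) \<or> (\<forall>y\<in>Y. connected {z\<in>linkvecs m l. cmod (\<Sum>j<m. z j) = cmod (W y)})"
    and one: "y1 \<in> Y" "connected {z\<in>linkvecs m l. cmod (\<Sum>j<m. z j) = cmod (W y1)}"
  shows "connected {(y,z). y \<in> Y \<and> z \<in> linkvecs m l \<and> (\<Sum>j<m. z j) = W y}"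
proof (rule connected_gauge[where e="\<lambda>z. \<Sum>j<m. z j"])
  show "connected {(y,z). y \<in> Y \<and> z \<in> linkvecs m l \<and> cmod (\<Sum>j<m. z j) = cmod (W y)}"
  proof (rule connected_fibre_product[OF Y _ compact_linkvecs _ sub _ one])
    show "continuous_on Y (\<lambda>y. cmod (W y))" by (intro continuous_intros W)
    show "continuous_on (linkvecs m l) (\<lambda>z. cmod (\<Sum>j<m. z j))" by (intro continuous_intros)
    fix y assume y: "y \<in> Y"
    show "connected {z\<in>linkvecs m l. cmod (\<Sum>j<m. z j) = cmod (W y)} \<or>
      (\<forall>z0\<in>linkvecs m l. cmod (\<Sum>j<m. z0 j) = cmod (W y) \<longrightarrow> (\<forall>U. open U \<longrightarrow> z0 \<in> U \<longrightarrow>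
        (\<exists>\<delta>>0. \<forall>t\<in>(\<lambda>z. cmod (\<Sum>j<m. z j)) ` linkvecs m l. \<bar>t - cmod (W y)\<bar> < \<delta> \<longrightarrow>
           (\<exists>z\<in>linkvecs m l \<inter> U. cmod (\<Sum>j<m. z j) = t))))"
      using lev
    proof
      assume pos: "\<forall>j<m. l j > 0"
      show ?thesis
      proof (rule disjI2, intro ballI impI allI)
        fix z0 U assume z0: "z0 \<in> linkvecs m l" "cmod (\<Sum>j<m. z0 j) = cmod (W y)" "open U" "z0 \<in> U"
        show "\<exists>\<delta>>0. \<forall>t\<in>(\<lambda>z. cmod (\<Sum>j<m. z j)) ` linkvecs m l. \<bar>t - cmod (W y)\<bar> < \<delta> \<longrightarrow>
           (\<exists>z\<in>linkvecs m l \<inter> U. cmod (\<Sum>j<m. z j) = t)"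
          using end_distance_open[OF _ z0(1,3,4)] pos unfolding z0(2) by blast
      qed
    qed (use y in blast)
  qed
qed (use W linkvecs_rotate in \<open>auto intro!: continuous_intros simp: sum_distrib_left\<close>)

lemma end_distance_connected: "connected ((\<lambda>z. cmod (\<Sum>j<m. z j)) ` linkvecs m l)"
  by (intro connected_continuous_image connected_linkvecs continuous_intros)

section \<open>Levels and range of the path Q\<close>

lemma connected_circle_cap:
  assumes "h \<le> x" "0 \<le> x"
  shows "connected {t. cmod t = x \<and> h \<le> Re t}"
proof -
  \<comment> \<open>The cap is the union of an upper and a lower arc, both graphs over
    \<open>?S\<close>, which meet at the real point \<open>x\<close>. The \<open>max\<close> covers
    the case \<open>h < - x\<close>, in which the cap is the whole circle.\<close>
  let ?S = "{max h (- x)..x}"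
  let ?f = "\<lambda>\<sigma> r. Complex r (\<sigma> * sqrt (x\<^sup>2 - r\<^sup>2))"
  have co: "connected (?f \<sigma> ` ?S)" for \<sigma>
  proof (rule connected_continuous_image)
    show "continuous_on ?S (?f \<sigma>)"
      unfolding Complex_eq by (intro continuous_intros)
  qed simp
  have x: "Complex x 0 \<in> ?f 1 ` ?S" "Complex x 0 \<in> ?f (-1) ` ?S"
    using assms by (auto intro!: image_eqI[of _ _ x])
  have "connected (?f 1 ` ?S \<union> ?f (-1) ` ?S)"
    by (intro connected_Un co) (use x in blast)
  also have "?f 1 ` ?S \<union> ?f (-1) ` ?S = {t. cmod t = x \<and> h \<le> Re t}"
  proof (intro set_eqI iffI)
    fix t assume "t \<in> ?f 1 ` ?S \<union> ?f (-1) ` ?S"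
    then obtain \<sigma> r where t: "t = ?f \<sigma> r" "\<sigma> = 1 \<or> \<sigma> = -1" "r \<in> ?S" by blast
    have "\<bar>r\<bar> \<le> x" using t(3) by (auto simp: abs_le_iff)
    then have "r\<^sup>2 \<le> x\<^sup>2" by (metis abs_ge_zero power2_abs power_mono)
    then have "(cmod t)\<^sup>2 = x\<^sup>2" using t(1,2) by (auto simp: cmod_power2)
    then show "t \<in> {t. cmod t = x \<and> h \<le> Re t}"
      using assms t by (auto simp: power2_eq_iff_nonneg)
  next
    fix t assume t: "t \<in> {t. cmod t = x \<and> h \<le> Re t}"
    then have "Re t \<in> ?S" using abs_Re_le_cmod[of t] by (auto simp: abs_le_iff)
    moreover have "x\<^sup>2 - (Re t)\<^sup>2 = (Im t)\<^sup>2" using t cmod_power2[of t] by auto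
    then have "t = ?f (if Im t \<ge> 0 then 1 else -1) (Re t)" by (simp add: complex_eq_iff)
    ultimately show "t \<in> ?f 1 ` ?S \<union> ?f (-1) ` ?S" by (cases "Im t \<ge> 0") auto
  qed
  finally show ?thesis .
qed

lemma three_edges_range:
  assumes "c > 0" "0 \<le> t" "t \<le> 3 * c"
  shows "t \<in> (\<lambda>z. cmod (\<Sum>j<3. z j)) ` linkvecs 3 (\<lambda>_. c)"
proof -
  \<comment> \<open>Symmetric placement: one edge along the real axis and the others at the angles
    \<phi> and \<open>- \<phi>\<close>, so that the total is
    \<open>c * (1 + 2 * cos \<phi>)\<close>.\<close>
  define \<phi> where "\<phi> = arccos ((t / c - 1) / 2)"
  have "t / c \<ge> 0" "t / c \<le> 3" using assms by (auto simp: field_simps)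
  then have cos: "cos \<phi> = (t / c - 1) / 2" unfolding \<phi>_def by (intro cos_arccos) auto
  define z :: "nat \<Rightarrow> complex" where
    "z j = (if j = 0 then of_real c else if j = 1 then of_real c * cis \<phi>
            else if j = 2 then of_real c * cis (- \<phi>) else 0)" for j
  have "z \<in> linkvecs 3 (\<lambda>_. c)" using assms by (auto simp: linkvecs_def z_def norm_mult)
  moreover have "(\<Sum>j<3. z j) = of_real t"
    using cos assms by (simp add: numeral_3_eq_3 z_def complex_eq_iff field_simps)
  then have "cmod (\<Sum>j<3. z j) = t" using assms by simp
  ultimately show ?thesis by (metis image_eqI)
qed

text \<open>Equality in the triangle inequality makes the three vectors equal, so the level is a
  single circle.\<close>

lemma three_edges_stretched_connected:
  assumes "c > 0"
  shows "connected {z \<in> linkvecs 3 (\<lambda>_. c). cmod (\<Sum>j<3. z j) = 3 * c}"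
proof -
  let ?f = "\<lambda>w :: complex. (\<lambda>j :: nat. if j < 3 then w else 0)"
  have "{z \<in> linkvecs 3 (\<lambda>_. c). cmod (\<Sum>j<3. z j) = 3 * c} = ?f ` sphere 0 c"
  proof (intro set_eqI iffI)
    fix z assume z: "z \<in> {z \<in> linkvecs 3 (\<lambda>_. c). cmod (\<Sum>j<3. z j) = 3 * c}"
    then have n: "cmod (z 0) = c" "cmod (z 1) = c" "cmod (z 2) = c" and "\<forall>j\<ge>3. z j = 0"
      by (auto simp: linkvecs_def)
    have s: "cmod (z 0 + z 1 + z 2) = 3 * c" using z by (simp add: numeral_3_eq_3 numeral_2_eq_2)
    have s2: "cmod (z 0 + z 1) = c + c"
      using n s norm_triangle_ineq[of "z 0 + z 1" "z 2"] norm_triangle_ineq[of "z 0" "z 1"] by linarith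
    then have "c *\<^sub>R z 1 = c *\<^sub>R z 0" using n norm_triangle_eq[of "z 0" "z 1"] by simp
    then have 1: "z 1 = z 0" using assms by simp
    have "cmod ((z 0 + z 1) + z 2) = cmod (z 0 + z 1) + cmod (z 2)" using s s2 n by simp
    from norm_triangle_eq[THEN iffD1, OF this]
    have "(c + c) *\<^sub>R z 2 = c *\<^sub>R (z 0 + z 1)" by (simp only: s2 n)
    then have "of_real c * (2 * z 2) = of_real c * (2 * z 0)"
      unfolding 1 by (simp add: scaleR_conv_of_real algebra_simps)
    then have 2: "z 2 = z 0" using assms by simp
    have "z = ?f (z 0)"
    proof
      fix j show "z j = ?f (z 0) j"
      proof (cases "j < 3")
        case True
        then have "j = 0 \<or> j = 1 \<or> j = 2" by auto
        then show ?thesis using 1 2 by auto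
      qed (use \<open>\<forall>j\<ge>3. z j = 0\<close> in auto)
    qed
    then show "z \<in> ?f ` sphere 0 c" using n by auto
  next
    fix z assume "z \<in> ?f ` sphere 0 c"
    then show "z \<in> {z \<in> linkvecs 3 (\<lambda>_. c). cmod (\<Sum>j<3. z j) = 3 * c}"
      by (auto simp: linkvecs_def norm_mult)
  qed
  moreover have "connected (?f ` sphere 0 c)"
  proof (rule connected_continuous_image)
    have "continuous_on (sphere 0 c) (\<lambda>w :: complex. if j < 3 then w else 0)" for j :: nat
      by (cases "j < 3") (auto intro: continuous_intros)
    then show "continuous_on (sphere 0 c) ?f" by (rule continuous_on_coordinatewise_then_product)
  qed (auto intro: connected_sphere)
  ultimately show ?thesis by simp
qed

definition long_edge :: "real \<Rightarrow> real \<Rightarrow> nat \<Rightarrow> real" where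
  "long_edge M c j = (if j = 0 then M else c)"

text \<open>With the first edge turned onto the real axis, the total of the short edges ranges over
  a translated circle cap. The short-edge configurations form a pullback over this connected set,
  with a connected fibre over its rim, where the short edges are stretched. Rotations restore the
  direction of the first edge.\<close>

lemma long_edge_level_connected:
  assumes c: "0 \<le> c" "3 * c \<le> M" and x: "M - 3 * c \<le> x" "x \<le> M + 3 * c"
  shows "connected {z \<in> linkvecs 4 (long_edge M c). cmod (\<Sum>j<4. z j) = x}"
proof (cases "c = 0")
  case True
  have "{z \<in> linkvecs 4 (long_edge M c). cmod (\<Sum>j<4. z j) = x} = linkvecs 4 (long_edge M c)"
    using x by (auto simp: True linkvecs_def long_edge_def eval_nat_numeral)
  then show ?thesis by (simp add: connected_linkvecs)
next
  case False
  then have c0: "c > 0" "M > 0" using c by auto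
  have x0: "0 \<le> x" using c x by simp
  \<comment> \<open>By the law of cosines, a point at distance \<open>x\<close> from 0 and
    \<open>3 * c\<close> from \<open>M\<close> has real part \<open>h\<close>.\<close>
  define h where "h = (x\<^sup>2 + M\<^sup>2 - 9 * c\<^sup>2) / (2 * M)"
  have d: "(cmod (t - of_real M))\<^sup>2 = x\<^sup>2 + M\<^sup>2 - 2 * M * Re t" if "cmod t = x" for t
  proof -
    have "(cmod t)\<^sup>2 = (Re t)\<^sup>2 + (Im t)\<^sup>2" by (rule cmod_power2)
    then show ?thesis unfolding that[symmetric]
      by (simp add: cmod_power2 power2_diff)
  qed
  have cap: "cmod (t - of_real M) \<le> 3 * c \<longleftrightarrow> h \<le> Re t" if "cmod t = x" for t
  proof -
    have "cmod (t - of_real M) \<le> 3 * c \<longleftrightarrow> (cmod (t - of_real M))\<^sup>2 \<le> (3 * c)\<^sup>2"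
      using c by (intro iffI power_mono) (auto intro: power2_le_imp_le)
    also have "\<dots> \<longleftrightarrow> h \<le> Re t"
      using c0 unfolding d[OF that] h_def by (simp add: field_simps power_mult_distrib)
    finally show ?thesis .
  qed
  have "(x - M)\<^sup>2 \<le> (3 * c)\<^sup>2" using x c by (intro abs_le_square_iff[THEN iffD1]) auto
  then have hx: "h \<le> x" using c0 unfolding h_def by (simp add: power2_eq_square field_simps)
  have "(3 * c)\<^sup>2 \<le> (x + M)\<^sup>2" using c x0 by (intro power_mono) auto
  then have hx': "- x \<le> h" using c0 unfolding h_def by (simp add: power2_eq_square field_simps)
  define Y where "Y = (\<lambda>t. t - of_real M) ` {t. cmod t = x \<and> h \<le> Re t}"
  have Yeq: "Y = {s. cmod (of_real M + s) = x \<and> cmod s \<le> 3 * c}"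
  proof (intro set_eqI iffI)
    fix s assume "s \<in> Y"
    then show "s \<in> {s. cmod (of_real M + s) = x \<and> cmod s \<le> 3 * c}" using cap by (auto simp: Y_def)
  next
    fix s assume "s \<in> {s. cmod (of_real M + s) = x \<and> cmod s \<le> 3 * c}"
    then have "of_real M + s \<in> {t. cmod t = x \<and> h \<le> Re t}" using cap[of "of_real M + s"] by simp
    then show "s \<in> Y" unfolding Y_def by (intro image_eqI[of _ _ "of_real M + s"]) simp_all
  qed
  have Ycon: "connected Y"
    unfolding Y_def by (intro connected_continuous_image connected_circle_cap hx x0 continuous_intros)
  \<comment> \<open>A rim point of the cap, chosen because the short edges are stretched over
    it.\<close>
  define t1 where "t1 = Complex h (sqrt (x\<^sup>2 - h\<^sup>2))"
  have "h\<^sup>2 \<le> x\<^sup>2" using hx hx' by (intro abs_le_square_iff[THEN iffD1]) auto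
  then have "(cmod t1)\<^sup>2 = x\<^sup>2" by (simp add: t1_def cmod_power2)
  then have t1: "cmod t1 = x" using x0 by (simp add: power2_eq_iff_nonneg)
  have "(cmod (t1 - of_real M))\<^sup>2 = (3 * c)\<^sup>2"
    using c0 unfolding d[OF t1] by (simp add: t1_def h_def power_mult_distrib)
  then have t1c: "cmod (t1 - of_real M) = 3 * c" by (rule power2_eq_imp_eq) (use c in simp_all)
  then have t1Y: "t1 - of_real M \<in> Y" using t1 by (simp add: Yeq)
  let ?T = "linkvecs 3 (\<lambda>_. c)"
  have "connected {(s,z). s \<in> Y \<and> z \<in> ?T \<and> (\<Sum>j<3. z j) = s}"
  proof (rule connected_attach_vectors[OF Ycon])
    show "(\<lambda>y. cmod y) ` Y \<subseteq> (\<lambda>z. cmod (\<Sum>j<3. z j)) ` ?T"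
      using three_edges_range[OF c0(1)] by (auto simp: Yeq)
    show "connected {z \<in> ?T. cmod (\<Sum>j<3. z j) = cmod (t1 - of_real M)}"
      unfolding t1c by (rule three_edges_stretched_connected[OF c0(1)])
  qed (use t1Y c0 in auto)
  then have "connected (snd ` {(s,z). s \<in> Y \<and> z \<in> ?T \<and> (\<Sum>j<3. z j) = s})"
    by (intro connected_continuous_image continuous_intros)
  moreover have "snd ` {(s,z). s \<in> Y \<and> z \<in> ?T \<and> (\<Sum>j<3. z j) = s} =
      {z \<in> ?T. cmod (of_real M + (\<Sum>j<3. z j)) = x}" (is "_ = ?G")
  proof -
    have "cmod (\<Sum>j<3. z j) \<le> 3 * c" if "z \<in> ?T" for z
      using that sum_norm_le[of "{..<3}" z "\<lambda>_. c"] by (auto simp: linkvecs_def)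
    then show ?thesis by (force simp: Yeq)
  qed
  ultimately have G: "connected ?G" by simp
  \<comment> \<open>The factor \<open>fst p\<close> turns the whole path; the index shift makes room
    for the long edge.\<close>
  let ?f = "\<lambda>p :: complex \<times> (nat \<Rightarrow> complex). \<lambda>j.
     if j = 0 then fst p * of_real M else fst p * snd p (j - 1)"
  have "?f ` (sphere 0 1 \<times> ?G) = {z \<in> linkvecs 4 (long_edge M c). cmod (\<Sum>j<4. z j) = x}"
  proof (intro set_eqI iffI)
    fix w assume "w \<in> ?f ` (sphere 0 1 \<times> ?G)"
    then obtain \<zeta> z where w: "w = ?f (\<zeta>, z)" and z: "cmod \<zeta> = 1" "z \<in> ?T" "cmod (of_real M + (\<Sum>j<3. z j)) = x"
      by auto
    have "(\<Sum>j<4. w j) = w 0 + (\<Sum>j<3. w (Suc j))"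
      using sum.lessThan_Suc_shift[of w 3] by simp
    also have "\<dots> = \<zeta> * (of_real M + (\<Sum>j<3. z j))" by (simp add: w sum_distrib_left algebra_simps)
    finally have "cmod (\<Sum>j<4. w j) = x" using z by (simp add: norm_mult)
    moreover have "w \<in> linkvecs 4 (long_edge M c)"
      using z c0 by (auto simp: w linkvecs_def long_edge_def norm_mult)
    ultimately show "w \<in> {z \<in> linkvecs 4 (long_edge M c). cmod (\<Sum>j<4. z j) = x}" by simp
  next
    fix w assume w: "w \<in> {z \<in> linkvecs 4 (long_edge M c). cmod (\<Sum>j<4. z j) = x}"
    define \<zeta> where "\<zeta> = w 0 / of_real M"
    have "cmod (w 0) = M" using w by (auto simp: linkvecs_def long_edge_def)
    then have \<zeta>: "cmod \<zeta> = 1" "w 0 = \<zeta> * of_real M" using c0 by (auto simp: \<zeta>_def norm_divide)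
    then have \<zeta>0: "\<zeta> \<noteq> 0" by auto
    define z where "z j = w (Suc j) / \<zeta>" for j
    have wz: "w (Suc j) = \<zeta> * z j" for j using \<zeta>0 by (simp add: z_def)
    have "(\<Sum>j<4. w j) = w 0 + (\<Sum>j<3. w (Suc j))"
      using sum.lessThan_Suc_shift[of w 3] by simp
    also have "\<dots> = \<zeta> * (of_real M + (\<Sum>j<3. z j))" by (simp add: \<zeta>(2) wz sum_distrib_left algebra_simps)
    finally have "cmod (of_real M + (\<Sum>j<3. z j)) = x" using \<zeta> w by (simp add: norm_mult)
    moreover have "z \<in> ?T"
      using w \<zeta> by (auto simp: linkvecs_def long_edge_def z_def norm_divide)
    moreover have "w = ?f (\<zeta>, z)"
      using \<zeta>(2) wz by (auto simp: fun_eq_iff) (metis Suc_pred)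
    ultimately show "w \<in> ?f ` (sphere 0 1 \<times> ?G)" using \<zeta>(1) by (intro image_eqI) auto
  qed
  moreover have "connected (?f ` (sphere 0 1 \<times> ?G))"
  proof (rule connected_continuous_image)
    have "continuous_on S (\<lambda>p :: complex \<times> (nat \<Rightarrow> complex). snd p k)" for S and k
      by (rule continuous_on_product_then_coordinatewise) (rule continuous_on_snd[OF continuous_on_id])
    then have "continuous_on S (\<lambda>p :: complex \<times> (nat \<Rightarrow> complex).
       if j = 0 then fst p * of_real M else fst p * snd p (j - 1))" for S and j :: nat
      by (cases "j = 0") (simp_all add: continuous_on_mult continuous_on_fst continuous_on_id)
    then show "continuous_on (sphere 0 1 \<times> ?G) ?f" by (rule continuous_on_coordinatewise_then_product)
  qed (use G in \<open>auto intro: connected_Times connected_sphere\<close>)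
  ultimately show ?thesis by simp
qed

lemma long_edge_range:
  assumes c: "0 \<le> c" "3 * c \<le> M"
  shows "(\<lambda>z. cmod (\<Sum>j<4. z j)) ` linkvecs 4 (long_edge M c) = {M - 3 * c..M + 3 * c}"
    (is "?R = _")
proof
  have s4: "(\<Sum>j<4. z j) = z 0 + (\<Sum>j<3. z (Suc j))" for z :: "nat \<Rightarrow> complex"
    using sum.lessThan_Suc_shift[of z 3] by simp
  show "?R \<subseteq> {M - 3 * c..M + 3 * c}"
  proof
    fix t assume "t \<in> ?R"
    then obtain z where z: "z \<in> linkvecs 4 (long_edge M c)" "t = cmod (z 0 + (\<Sum>j<3. z (Suc j)))"
      using s4 by auto
    have "cmod (z 0) = M" using z by (auto simp: linkvecs_def long_edge_def)
    moreover have "cmod (\<Sum>j<3. z (Suc j)) \<le> (\<Sum>j<3::nat. c)"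
      by (rule sum_norm_le) (use z in \<open>auto simp: linkvecs_def long_edge_def\<close>)
    ultimately show "t \<in> {M - 3 * c..M + 3 * c}"
      using norm_triangle_ineq[of "z 0" "\<Sum>j<3. z (Suc j)"] norm_diff_ineq[of "z 0" "\<Sum>j<3. z (Suc j)"] z(2)
      by simp
  qed
  \<comment> \<open>Short edges all along or all against the long one give the two ends of the
    range.\<close>
  have "M + 3 * \<sigma> * c \<in> ?R" if \<sigma>: "\<sigma> = 1 \<or> \<sigma> = -1" for \<sigma>
  proof -
    define z :: "nat \<Rightarrow> complex" where "z j = (if j = 0 then of_real M else if j < 4 then of_real (\<sigma> * c) else 0)" for j
    have "z \<in> linkvecs 4 (long_edge M c)" using \<sigma> c by (auto simp: linkvecs_def z_def long_edge_def)
    moreover have "(\<Sum>j<4. z j) = of_real (M + 3 * \<sigma> * c)" unfolding s4 by (simp add: z_def)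
    then have "cmod (\<Sum>j<4. z j) = M + 3 * \<sigma> * c" using c \<sigma> by (simp only: norm_of_real) auto
    ultimately show ?thesis by (metis image_eqI)
  qed
  from this[of "-1"] this[of 1] have R: "M - 3 * c \<in> ?R" "M + 3 * c \<in> ?R" by simp_all
  show "{M - 3 * c..M + 3 * c} \<subseteq> ?R"
  proof
    fix t assume "t \<in> {M - 3 * c..M + 3 * c}"
    then have t: "M - 3 * c \<le> t" "t \<le> M + 3 * c" by simp_all
    show "t \<in> ?R" by (rule connectedD_interval[OF end_distance_connected R t])
  qed
qed

section \<open>Attaching a path to a linkage\<close>

text \<open>A path lists vertices while edges are names; \<open>is_path\<close> makes
  \<open>lends\<close> injective on the path edges, so the name is recovered from the two
  ends.\<close>

definition path_edge :: "('v,'e) linkage \<Rightarrow> 'e set \<Rightarrow> 'v list \<Rightarrow> nat \<Rightarrow> 'e" where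
  "path_edge M Es xs j = inv_into Es (lends M) {xs ! j, xs ! Suc j}"

definition edge_len :: "('v,'e) linkage \<Rightarrow> 'e set \<Rightarrow> 'v list \<Rightarrow> nat \<Rightarrow> real" where
  "edge_len M Es xs j = llen M (path_edge M Es xs j)"

definition edge_vecs :: "'v list \<Rightarrow> ('v \<Rightarrow> complex) \<Rightarrow> nat \<Rightarrow> complex" where
  "edge_vecs xs p j = (if Suc j < length xs then p (xs ! Suc j) - p (xs ! j) else 0)"

definition position :: "'v list \<Rightarrow> 'v \<Rightarrow> nat" where
  "position xs x = (THE j. j < length xs \<and> xs ! j = x)"

text \<open>In its uses \<open>V\<close> contains both terminals, so they keep the positions given
  by \<open>y\<close>; the inner vertices are reached by partial sums from the start of the
  path.\<close>

definition attach :: "'v set \<Rightarrow> 'v list \<Rightarrow> ('v \<Rightarrow> complex) \<Rightarrow> (nat \<Rightarrow> complex) \<Rightarrow> 'v \<Rightarrow> complex" where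
  "attach V xs y z x = (if x \<in> V then y x else if x \<in> set xs then y (hd xs) + (\<Sum>i<position xs x. z i) else 0)"

definition restr :: "'v set \<Rightarrow> ('v \<Rightarrow> complex) \<Rightarrow> 'v \<Rightarrow> complex" where
  "restr V p x = (if x \<in> V then p x else 0)"

lemma position_nth: "distinct xs \<Longrightarrow> j < length xs \<Longrightarrow> position xs (xs ! j) = j"
  unfolding position_def by (rule the_equality) (auto simp: nth_eq_iff_index_eq)

lemma sublk_simps [simp]:
  "lverts (sublk L V S) = V" "ledges (sublk L V S) = S" "lends (sublk L V S) = lends L" "llen (sublk L V S) = llen L"
  by (simp_all add: sublk_def)

lemma mem_Cfg_sublk:
  "p \<in> Cfg (sublk L V S) \<longleftrightarrow> (\<forall>x. x \<notin> V \<longrightarrow> p x = 0) \<and>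
     (\<forall>e\<in>S. \<forall>x y. lends L e = {x, y} \<longrightarrow> cmod (p x - p y) = llen L e)"
  by (simp add: Cfg_def)

lemma restr_Cfg:
  assumes "p \<in> Cfg (sublk L V S)" "S' \<subseteq> S" "\<And>e. e \<in> S' \<Longrightarrow> lends L e \<subseteq> V'"
  shows "restr V' p \<in> Cfg (sublk L V' S')"
  unfolding mem_Cfg_sublk
proof (intro conjI allI ballI impI)
  fix e x y assume e: "e \<in> S'" "lends L e = {x, y}"
  then have "x \<in> V'" "y \<in> V'" using assms(3)[OF e(1)] by auto
  then show "cmod (restr V' p x - restr V' p y) = llen L e"
    using e assms(1,2) by (auto simp: restr_def mem_Cfg_sublk)
qed (simp add: restr_def)

lemma continuous_on_restr: "continuous_on A (restr V)"
proof (rule continuous_on_coordinatewise_then_product)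
  show "continuous_on A (\<lambda>p. restr V p x)" for x
    by (cases "x \<in> V") (auto simp: restr_def intro!: continuous_intros)
qed

locale path_in_linkage =
  fixes M :: "('v,'e) linkage" and Es :: "'e set" and xs :: "'v list" and u v :: 'v
  assumes is_path: "is_path M Es xs" and hd: "hd xs = u" and last: "last xs = v"
begin

abbreviation m where "m \<equiv> length xs - 1"
abbreviation l where "l \<equiv> edge_len M Es xs"

lemma len: "length xs \<ge> 2" and dist_xs: "distinct xs"
  and bij: "bij_betw (lends M) Es {{xs ! j, xs ! Suc j} | j. Suc j < length xs}"
  using is_path by (auto simp: is_path_def)

lemma nonempty: "xs \<noteq> []" using len by auto

lemma u_nth: "u = xs ! 0" and v_nth: "v = xs ! m"
  using hd last nonempty by (simp_all add: hd_conv_nth last_conv_nth)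

lemma uv_mem: "u \<in> set xs" "v \<in> set xs"
  using hd last nonempty by auto

lemma path_edge: assumes "Suc j < length xs"
  shows "path_edge M Es xs j \<in> Es" "lends M (path_edge M Es xs j) = {xs ! j, xs ! Suc j}"
proof -
  have "{xs ! j, xs ! Suc j} \<in> lends M ` Es" using bij assms unfolding bij_betw_def by auto
  then show "path_edge M Es xs j \<in> Es" "lends M (path_edge M Es xs j) = {xs ! j, xs ! Suc j}"
    unfolding path_edge_def by (rule inv_into_into, rule f_inv_into_f)
qed

lemma edge_ex: assumes "e \<in> Es"
  obtains j where "Suc j < length xs" "e = path_edge M Es xs j" "lends M e = {xs ! j, xs ! Suc j}"
proof -
  obtain j where j: "Suc j < length xs" "lends M e = {xs ! j, xs ! Suc j}"
    using bij assms unfolding bij_betw_def by blast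
  have "e = path_edge M Es xs j"
    using path_edge[OF j(1)] j(2) assms bij unfolding bij_betw_def inj_on_def by metis
  then show thesis using that j by blast
qed

lemma edges_within: "e \<in> Es \<Longrightarrow> lends M e \<subseteq> set xs"
  by (erule edge_ex) auto

lemma l_pos: "(\<And>e. e \<in> Es \<Longrightarrow> llen M e > 0) \<Longrightarrow> j < m \<Longrightarrow> l j > 0"
  using path_edge(1)[of j] by (simp add: edge_len_def less_diff_conv)

lemma path_edges_iff:
  "(\<forall>e\<in>Es. \<forall>x y. lends M e = {x, y} \<longrightarrow> cmod (p x - p y) = llen M e) \<longleftrightarrow> edge_vecs xs p \<in> linkvecs m l"
    (is "?A \<longleftrightarrow> ?B")
proof
  assume A: ?A
  show ?B unfolding linkvecs_def
  proof (intro CollectI conjI allI impI)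
    fix j assume "j < m"
    then have j: "Suc j < length xs" by simp
    then show "cmod (edge_vecs xs p j) = l j"
      using A path_edge[OF j] unfolding edge_len_def edge_vecs_def by (simp add: norm_minus_commute)
  qed (auto simp: edge_vecs_def)
next
  assume B: ?B
  show ?A
  proof (intro ballI allI impI)
    fix e x y assume e: "e \<in> Es" "lends M e = {x, y}"
    obtain j where j: "Suc j < length xs" "e = path_edge M Es xs j" "lends M e = {xs ! j, xs ! Suc j}"
      using edge_ex[OF e(1)] .
    then have "j < m" by simp
    then have "cmod (edge_vecs xs p j) = l j" using B by (simp add: linkvecs_def)
    then have "cmod (p (xs ! Suc j) - p (xs ! j)) = llen M e"
      using j(1,2) by (simp add: edge_vecs_def edge_len_def)
    moreover have "(x = xs ! j \<and> y = xs ! Suc j) \<or> (x = xs ! Suc j \<and> y = xs ! j)"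
      using e(2) j(3) by (metis doubleton_eq_iff)
    ultimately show "cmod (p x - p y) = llen M e" by (auto simp: norm_minus_commute)
  qed
qed

lemma sum_edge_vecs_upto: "j < length xs \<Longrightarrow> (\<Sum>i<j. edge_vecs xs p i) = p (xs ! j) - p u"
  by (induction j) (auto simp: edge_vecs_def u_nth)

lemma sum_edge_vecs: "(\<Sum>i<m. edge_vecs xs p i) = p v - p u"
  using sum_edge_vecs_upto[of m p] len v_nth by simp

lemma Cfg_edge_vecs:
  "p \<in> Cfg (sublk M V S) \<Longrightarrow> Es \<subseteq> S \<Longrightarrow> edge_vecs xs p \<in> linkvecs m l"
  unfolding path_edges_iff[symmetric] mem_Cfg_sublk by blast

lemma continuous_on_edge_vecs: "continuous_on A (edge_vecs xs)"
proof (rule continuous_on_coordinatewise_then_product)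
  show "continuous_on A (\<lambda>p. edge_vecs xs p j)" for j
    by (cases "Suc j < length xs") (auto simp: edge_vecs_def intro!: continuous_intros)
qed

end

text \<open>\<open>V\<close> and \<open>S\<close> are the rest of the linkage. It shares only the
  terminals with the path, so the inner vertices of the path are constrained by the path edges
  alone.\<close>

locale attached_path = path_in_linkage M Es xs u v
  for M :: "('v,'e) linkage" and Es xs u v +
  fixes V :: "'v set" and S :: "'e set"
  assumes meet: "set xs \<inter> V = {u, v}" and within: "\<And>e. e \<in> S \<Longrightarrow> lends M e \<subseteq> V"
begin

lemma uv_V: "u \<in> V" "v \<in> V" using meet by auto

text \<open>At \<open>v\<close>, which lies in \<open>V\<close>, the formula is the closing
  condition on \<open>z\<close>.\<close>

lemma attach_nth:
  assumes "(\<Sum>i<m. z i) = y v - y u" "j < length xs"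
  shows "attach V xs y z (xs ! j) = y u + (\<Sum>i<j. z i)"
proof (cases "xs ! j \<in> V")
  case True
  then have "xs ! j = u \<or> xs ! j = v" using meet assms(2) nth_mem by blast
  then have "j = 0 \<or> j = m"
    using dist_xs assms(2) len unfolding u_nth v_nth by (subst (asm) (1 2) nth_eq_iff_index_eq) auto
  then show ?thesis using True assms(1) u_nth v_nth by (auto simp: attach_def)
next
  case False
  then show ?thesis using assms(2) position_nth[OF dist_xs assms(2)] by (simp add: attach_def hd)
qed

lemma edge_vecs_attach:
  assumes "z \<in> linkvecs m l" "(\<Sum>i<m. z i) = y v - y u"
  shows "edge_vecs xs (attach V xs y z) = z"
proof
  fix j show "edge_vecs xs (attach V xs y z) j = z j"
    using attach_nth[OF assms(2), of j] attach_nth[OF assms(2), of "Suc j"] assms(1)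
    by (cases "Suc j < length xs") (auto simp: edge_vecs_def linkvecs_def)
qed

text \<open>\<open>I\<close> is a constraint on the terminal distance that outlives the removal of a
  path; without it \<open>base\<close> could contain configurations to which the path cannot be
  attached.\<close>

definition base where "base I = {p \<in> Cfg (sublk M V S). cmod (p u - p v) \<in> I}"
definition total where "total I = {p \<in> Cfg (sublk M (V \<union> set xs) (S \<union> Es)). cmod (p u - p v) \<in> I}"

lemma restr_total: "p \<in> total I \<Longrightarrow> restr V p \<in> base I"
  using restr_Cfg[of p M "V \<union> set xs" "S \<union> Es" S V] within uv_V
  by (auto simp: total_def base_def restr_def)

lemma attach_total:
  assumes y: "y \<in> base I" and z: "z \<in> linkvecs m l" "(\<Sum>i<m. z i) = y v - y u"
  shows "attach V xs y z \<in> total I" "restr V (attach V xs y z) = y"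
proof -
  let ?p = "attach V xs y z"
  have yC: "y \<in> Cfg (sublk M V S)" and yI: "cmod (y u - y v) \<in> I" using y by (auto simp: base_def)
  have pV: "?p x = y x" if "x \<in> V" for x using that by (simp add: attach_def)
  have "cmod (?p x - ?p y') = llen M e" if e: "e \<in> S" "lends M e = {x, y'}" for e x y'
    using within[OF e(1)] e yC pV[of x] pV[of y'] by (auto simp: mem_Cfg_sublk)
  moreover have "\<forall>e\<in>Es. \<forall>x y'. lends M e = {x, y'} \<longrightarrow> cmod (?p x - ?p y') = llen M e"
    unfolding path_edges_iff edge_vecs_attach[OF z] by (rule z)
  ultimately have "?p \<in> Cfg (sublk M (V \<union> set xs) (S \<union> Es))"
    unfolding mem_Cfg_sublk
  proof (intro conjI ballI)
    show "\<forall>x. x \<notin> V \<union> set xs \<longrightarrow> ?p x = 0" by (simp add: attach_def)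
  qed blast
  then show "?p \<in> total I" using yI pV uv_V by (simp add: total_def)
  show "restr V ?p = y" using yC by (auto simp: fun_eq_iff restr_def attach_def mem_Cfg_sublk)
qed

lemma attach_edge_vecs:
  assumes p: "p \<in> Cfg (sublk M (V \<union> set xs) (S \<union> Es))"
  shows "attach V xs (restr V p) (edge_vecs xs p) = p"
proof
  fix x
  let ?y = "restr V p"
  have s: "(\<Sum>i<m. edge_vecs xs p i) = ?y v - ?y u" using sum_edge_vecs uv_V by (simp add: restr_def)
  show "attach V xs ?y (edge_vecs xs p) x = p x"
  proof (cases "x \<in> set xs")
    case True
    then obtain j where j: "j < length xs" "x = xs ! j" by (metis in_set_conv_nth)
    have "?y u = p u" using uv_V by (simp add: restr_def)
    then show ?thesis unfolding j(2) attach_nth[OF s j(1)] sum_edge_vecs_upto[OF j(1)] by simp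
  next
    case False
    then show ?thesis using p by (auto simp: attach_def restr_def mem_Cfg_sublk)
  qed
qed

lemma continuous_on_attach: "continuous_on A (\<lambda>(y, z). attach V xs y z)"
  unfolding case_prod_beta
proof (rule continuous_on_coordinatewise_then_product)
  have 1: "continuous_on A (\<lambda>p :: ('v \<Rightarrow> complex) \<times> (nat \<Rightarrow> complex). fst p k)" for k
    by (rule continuous_on_product_then_coordinatewise) (rule continuous_on_fst[OF continuous_on_id])
  have 2: "continuous_on A (\<lambda>p :: ('v \<Rightarrow> complex) \<times> (nat \<Rightarrow> complex). snd p k)" for k
    by (rule continuous_on_product_then_coordinatewise) (rule continuous_on_snd[OF continuous_on_id])
  show "continuous_on A (\<lambda>p. attach V xs (fst p) (snd p) x)" for x
  proof (cases "x \<in> V")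
    case True then show ?thesis using 1 by (simp add: attach_def)
  next
    case False
    show ?thesis
    proof (cases "x \<in> set xs")
      case True then show ?thesis using False 1 2
        by (simp add: attach_def continuous_on_add continuous_on_sum)
    qed (use False in \<open>simp add: attach_def\<close>)
  qed
qed

abbreviation reach where "reach \<equiv> (\<lambda>z. cmod (\<Sum>j<m. z j)) ` linkvecs m l"

lemma ex_vec_of_norm:
  assumes "cmod w \<in> reach"
  obtains z where "z \<in> linkvecs m l" "(\<Sum>j<m. z j) = w"
proof -
  from assms obtain z where z: "cmod w = cmod (\<Sum>j<m. z j)" "z \<in> linkvecs m l" by (rule imageE)
  obtain c where c: "cmod c = 1" "c * (\<Sum>j<m. z j) = w"
  proof (cases "w = 0")
    case True then show ?thesis using that[of 1] z by auto
  next
    case False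
    then have "(\<Sum>j<m. z j) \<noteq> 0" using z by auto
    then show ?thesis using that[of "w / (\<Sum>j<m. z j)"] z False by (simp add: norm_divide)
  qed
  then show thesis
    using that[of "\<lambda>j. c * z j"] linkvecs_rotate[OF c(1) z(2)] by (simp add: sum_distrib_left)
qed

text \<open>Restriction is onto because the path attains every distance in \<open>I\<close> and can
  be rotated into the required direction.\<close>

lemma base_eq: assumes "I \<subseteq> reach" shows "base I = restr V ` total I"
proof
  show "base I \<subseteq> restr V ` total I"
  proof
    fix y assume y: "y \<in> base I"
    then have "cmod (y v - y u) \<in> reach" using assms by (auto simp: base_def norm_minus_commute)
    then obtain z where "z \<in> linkvecs m l" "(\<Sum>j<m. z j) = y v - y u" by (rule ex_vec_of_norm)
    from attach_total[OF y this] show "y \<in> restr V ` total I" by force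
  qed
qed (use restr_total in blast)

lemma connected_base: "connected (total I) \<Longrightarrow> I \<subseteq> reach \<Longrightarrow> connected (base I)"
  unfolding base_eq by (intro connected_continuous_image continuous_on_restr)

text \<open>A configuration of the whole amounts to one of the rest together with edge vectors
  adding up to the terminal displacement. \<open>attach\<close> carries connectedness over from the
  space of such pairs.\<close>

lemma connected_total:
  assumes con: "connected (base I)" and I: "I \<subseteq> reach"
    and lev: "(\<forall>j<m. l j > 0) \<or> (\<forall>t\<in>I. connected {z\<in>linkvecs m l. cmod (\<Sum>j<m. z j) = t})"
    and one: "y1 \<in> base I" "connected {z\<in>linkvecs m l. cmod (\<Sum>j<m. z j) = cmod (y1 u - y1 v)}"
  shows "connected (total I)"
proof -
  let ?E = "{(y,z). y \<in> base I \<and> z \<in> linkvecs m l \<and> (\<Sum>j<m. z j) = y v - y u}"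
  have bI: "cmod (y v - y u) \<in> I" if "y \<in> base I" for y
    using that by (simp add: base_def norm_minus_commute)
  have "connected ?E"
  proof (rule connected_attach_vectors[OF con _ _ _ one(1)])
    show "continuous_on (base I) (\<lambda>y. y v - y u)" by (intro continuous_intros)
    show "(\<lambda>y. cmod (y v - y u)) ` base I \<subseteq> reach" using bI I by blast
    show "(\<forall>j<m. l j > 0) \<or> (\<forall>y\<in>base I. connected {z\<in>linkvecs m l. cmod (\<Sum>j<m. z j) = cmod (y v - y u)})"
      using lev bI by blast
    show "connected {z\<in>linkvecs m l. cmod (\<Sum>j<m. z j) = cmod (y1 v - y1 u)}"
      using one(2) by (simp add: norm_minus_commute)
  qed
  then have "connected ((\<lambda>(y, z). attach V xs y z) ` ?E)"
    by (intro connected_continuous_image continuous_on_attach)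
  moreover have "(\<lambda>(y, z). attach V xs y z) ` ?E = total I"
  proof
    show "(\<lambda>(y, z). attach V xs y z) ` ?E \<subseteq> total I" using attach_total(1) by auto
    show "total I \<subseteq> (\<lambda>(y, z). attach V xs y z) ` ?E"
    proof
      fix p assume p: "p \<in> total I"
      then have pC: "p \<in> Cfg (sublk M (V \<union> set xs) (S \<union> Es))" by (simp add: total_def)
      have "edge_vecs xs p \<in> linkvecs m l" by (rule Cfg_edge_vecs[OF pC]) simp
      moreover have "(\<Sum>i<m. edge_vecs xs p i) = restr V p v - restr V p u"
        using sum_edge_vecs uv_V by (simp add: restr_def)
      ultimately have "(restr V p, edge_vecs xs p) \<in> ?E" using restr_total[OF p] by simp
      moreover have "p = (\<lambda>(y, z). attach V xs y z) (restr V p, edge_vecs xs p)"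
        using attach_edge_vecs[OF pC] by simp
      ultimately show "p \<in> (\<lambda>(y, z). attach V xs y z) ` ?E" by (rule image_eqI[rotated])
    qed
  qed
  ultimately show ?thesis by simp
qed

end

section \<open>Distances and levels of a single path\<close>

context path_in_linkage
begin

lemma ex_path_Cfg:
  assumes z: "z \<in> linkvecs m l"
  obtains p where "p \<in> Cfg (sublk M (set xs) Es)" "edge_vecs xs p = z"
proof -
  \<comment> \<open>The path by itself is regarded as attached to two terminals without edges, so
    that \<open>attach\<close> supplies the configuration.\<close>
  interpret attached_path M Es xs u v "{u, v}" "{}"
    by unfold_locales (use uv_mem in auto)
  have "u \<noteq> v" unfolding u_nth v_nth using len by (subst nth_eq_iff_index_eq[OF dist_xs]) auto
  define y where "y = (\<lambda>x. if x = v then \<Sum>j<m. z j else 0)"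
  have y: "(\<Sum>j<m. z j) = y v - y u" using \<open>u \<noteq> v\<close> by (simp add: y_def)
  have "y \<in> base UNIV" by (simp add: base_def mem_Cfg_sublk y_def)
  from attach_total(1)[OF this z y]
  have "attach {u, v} xs y z \<in> Cfg (sublk M (set xs) Es)"
    using uv_mem by (simp add: total_def insert_absorb)
  then show thesis using that edge_vecs_attach[OF z y] by blast
qed

lemma dists_eq: "dists (sublk M (set xs) Es) u v = (\<lambda>z. cmod (\<Sum>j<m. z j)) ` linkvecs m l"
proof (intro set_eqI iffI)
  fix t assume "t \<in> dists (sublk M (set xs) Es) u v"
  then obtain p where p: "p \<in> Cfg (sublk M (set xs) Es)" "t = cmod (p u - p v)" by (auto simp: dists_def)
  have "edge_vecs xs p \<in> linkvecs m l" by (rule Cfg_edge_vecs[OF p(1)]) simp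
  moreover have "t = cmod (\<Sum>j<m. edge_vecs xs p j)"
    unfolding sum_edge_vecs p(2) by (rule norm_minus_commute)
  ultimately show "t \<in> (\<lambda>z. cmod (\<Sum>j<m. z j)) ` linkvecs m l" by blast
next
  fix t assume "t \<in> (\<lambda>z. cmod (\<Sum>j<m. z j)) ` linkvecs m l"
  then obtain z where z: "t = cmod (\<Sum>j<m. z j)" "z \<in> linkvecs m l" by (rule imageE)
  obtain p where p: "p \<in> Cfg (sublk M (set xs) Es)" "edge_vecs xs p = z" by (rule ex_path_Cfg[OF z(2)])
  have "t = cmod (p u - p v)"
    using sum_edge_vecs[of p] z(1) unfolding p(2) by (simp add: norm_minus_commute)
  then show "t \<in> dists (sublk M (set xs) Es) u v" using p(1) unfolding dists_def by blast
qed

text \<open>The distances are a continuous image of a compact connected set, so \<open>Inf\<close>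
  and \<open>Sup\<close> are attained, as is everything between them.\<close>

lemma dists_interval:
  assumes "dists (sublk M (set xs) Es) u v \<noteq> {}"
  shows "dists (sublk M (set xs) Es) u v =
      {Inf (dists (sublk M (set xs) Es) u v)..Sup (dists (sublk M (set xs) Es) u v)}"
    and "0 \<le> Inf (dists (sublk M (set xs) Es) u v)"
proof -
  let ?D = "dists (sublk M (set xs) Es) u v"
  show "0 \<le> Inf ?D"
    by (rule cInf_greatest[OF assms]) (auto simp: dists_def)
  have con: "connected ?D" unfolding dists_eq by (rule end_distance_connected)
  have com: "compact ?D" unfolding dists_eq
    by (intro compact_continuous_image compact_linkvecs continuous_intros)
  note bd = bounded_imp_bdd_below[OF compact_imp_bounded[OF com]]
    bounded_imp_bdd_above[OF compact_imp_bounded[OF com]]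
  have mem: "Inf ?D \<in> ?D" "Sup ?D \<in> ?D"
    using closed_contains_Inf[OF assms bd(1)] closed_contains_Sup[OF assms bd(2)]
      compact_imp_closed[OF com] by simp_all
  show "?D = {Inf ?D..Sup ?D}"
  proof (intro set_eqI iffI)
    fix t assume "t \<in> {Inf ?D..Sup ?D}"
    then have t: "Inf ?D \<le> t" "t \<le> Sup ?D" by simp_all
    show "t \<in> ?D" by (rule connectedD_interval[OF con mem t])
  qed (simp add: cInf_lower[OF _ bd(1)] cSup_upper[OF _ bd(2)])
qed

text \<open>\<open>nabla\<close> concerns positions of vertices, the pullback edge vectors; the
  passage from one to the other is continuous and onto.\<close>

lemma level_connected:
  assumes "connected {p \<in> Cfg (sublk M (set xs) Es). cmod (p u - p v) = t}"
  shows "connected {z \<in> linkvecs m l. cmod (\<Sum>j<m. z j) = t}"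
proof -
  have "edge_vecs xs ` {p \<in> Cfg (sublk M (set xs) Es). cmod (p u - p v) = t} =
      {z \<in> linkvecs m l. cmod (\<Sum>j<m. z j) = t}"
  proof (intro set_eqI iffI)
    fix z assume "z \<in> edge_vecs xs ` {p \<in> Cfg (sublk M (set xs) Es). cmod (p u - p v) = t}"
    then obtain p where p: "p \<in> Cfg (sublk M (set xs) Es)" "cmod (p u - p v) = t" "z = edge_vecs xs p"
      by blast
    have "z \<in> linkvecs m l" unfolding p(3) by (rule Cfg_edge_vecs[OF p(1)]) simp
    moreover have "cmod (\<Sum>j<m. z j) = t"
      unfolding p(3) sum_edge_vecs using p(2) by (simp add: norm_minus_commute)
    ultimately show "z \<in> {z \<in> linkvecs m l. cmod (\<Sum>j<m. z j) = t}" by blast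
  next
    fix z assume z: "z \<in> {z \<in> linkvecs m l. cmod (\<Sum>j<m. z j) = t}"
    then obtain p where p: "p \<in> Cfg (sublk M (set xs) Es)" "edge_vecs xs p = z"
      using ex_path_Cfg[of z] by blast
    have "cmod (p u - p v) = t"
      using z sum_edge_vecs[of p] unfolding p(2) by (simp add: norm_minus_commute)
    then show "z \<in> edge_vecs xs ` {p \<in> Cfg (sublk M (set xs) Es). cmod (p u - p v) = t}"
      using p by blast
  qed
  then show ?thesis
    using connected_continuous_image[OF continuous_on_edge_vecs assms] by simp
qed

end

section \<open>Replacing the paths\<close>

lemma linkvecs_cong: "(\<And>j. j < m \<Longrightarrow> l j = l' j) \<Longrightarrow> linkvecs m l = linkvecs m l'"
  by (auto simp: linkvecs_def)

lemma sublk_self: "sublk L (lverts L) (ledges L) = L"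
  by (simp add: sublk_def)

section \<open>The path Q inside \<open>L1\<close>\<close>

abbreviation Q_path :: "'v \<Rightarrow> 'v \<Rightarrow> ('v + nat) list" where
  "Q_path u v \<equiv> [Inl u, Inr 1, Inr 2, Inr 3, Inl v]"

lemma L1_lends:
  "lends (L1 L EK u v a b) (Inl e) = Inl ` lends L e"
  "lends (L1 L EK u v a b) (Inr 1) = {Inl u, Inr 1}"
  "lends (L1 L EK u v a b) (Inr 2) = {Inr 1, Inr 2}"
  "lends (L1 L EK u v a b) (Inr 3) = {Inr 2, Inr 3}"
  "lends (L1 L EK u v a b) (Inr 4) = {Inr 3, Inl v}"
  by (simp_all add: L1_def)

lemma Q_path_edges:
  "{{Q_path u v ! j, Q_path u v ! Suc j} | j. Suc j < length (Q_path u v)} =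
     {{Inl u, Inr 1}, {Inr 1, Inr 2}, {Inr 2, Inr 3}, {Inr 3, Inl v}}" (is "?A = ?B")
proof -
  have "?A = (\<lambda>j. {Q_path u v ! j, Q_path u v ! Suc j}) ` {j. Suc j < 5}" by auto
  also have "{j. Suc j < 5} = {0, 1, 2, 3}" by auto
  also have "(\<lambda>j. {Q_path u v ! j, Q_path u v ! Suc j}) ` {0, 1, 2, 3} = ?B"
    by (simp add: numeral_2_eq_2 numeral_3_eq_3)
  finally show ?thesis .
qed

lemma attached_path_L1:
  assumes "u \<noteq> v"
  shows "attached_path (L1 L EK u v a b) (Inr ` {1, 2, 3, 4}) (Q_path u v) (Inl u) (Inl v)
           (Inl ` (everts L EK \<union> {u, v})) (Inl ` EK)"
proof
  have "bij_betw (lends (L1 L EK u v a b)) (Inr ` {1, 2, 3, 4})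
     {{Inl u, Inr 1}, {Inr 1, Inr 2}, {Inr 2, Inr 3}, {Inr 3, Inl v}}"
  proof (rule bij_betw_imageI)
    show "inj_on (lends (L1 L EK u v a b)) (Inr ` {1, 2, 3, 4})"
      by (simp add: inj_on_def L1_lends doubleton_eq_iff del: One_nat_def)
  qed (simp add: L1_lends del: One_nat_def)
  then show "is_path (L1 L EK u v a b) (Inr ` {1, 2, 3, 4}) (Q_path u v)"
    unfolding is_path_def Q_path_edges using assms by (auto simp: L1_def)
next
  fix e' :: "'b + nat" assume "e' \<in> Inl ` EK"
  then obtain e where "e \<in> EK" "e' = Inl e" by blast
  then show "lends (L1 L EK u v a b) e' \<subseteq> Inl ` (everts L EK \<union> {u, v})"
    by (simp only: L1_lends) (intro image_mono, blast)
qed auto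

text \<open>\<open>path_edge\<close> is given by an inverse image, so the edge name has to be found
  from its ends. It is \<open>Inr (Suc j)\<close>, the names being counted from 1.\<close>

lemma edge_len_L1:
  assumes "u \<noteq> v" "j < 4"
  shows "edge_len (L1 L EK u v a b) (Inr ` {1, 2, 3, 4}) (Q_path u v) j = long_edge ((a + b) / 2) ((b - a) / 6) j"
proof -
  interpret attached_path "L1 L EK u v a b" "Inr ` {1, 2, 3, 4}" "Q_path u v" "Inl u" "Inl v"
      "Inl ` (everts L EK \<union> {u, v})" "Inl ` EK"
    by (rule attached_path_L1[OF assms(1)])
  let ?e = "path_edge (L1 L EK u v a b) (Inr ` {1, 2, 3, 4}) (Q_path u v) j"
  have e: "?e \<in> Inr ` {1, 2, 3, 4}" "lends (L1 L EK u v a b) ?e = {Q_path u v ! j, Q_path u v ! Suc j}"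
    using path_edge[of j] assms(2) by auto
  obtain k where k: "?e = Inr k" "k = 1 \<or> k = 2 \<or> k = 3 \<or> k = 4" using e(1) by blast
  have "j = 0 \<or> j = 1 \<or> j = 2 \<or> j = 3" using assms(2) by auto
  then have "?e = Inr (Suc j)"
    using k(2) e(2) unfolding k(1) by (elim disjE; simp add: L1_def doubleton_eq_iff numeral_2_eq_2 numeral_3_eq_3)
  then show ?thesis by (simp add: edge_len_def L1_def long_edge_def)
qed

text \<open>Tagging is a homeomorphism of configuration spaces: configurations vanish on all
  \<open>Inr\<close> vertices here, so nothing is lost by forgetting them.\<close>

lemma connected_inl_iff:
  fixes L :: "('v, 'e) linkage" and L' :: "('v + 'x, 'e + 'y) linkage"
  assumes S: "\<And>e. e \<in> S \<Longrightarrow> lends L e \<subseteq> V"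
    and L': "\<And>e. e \<in> S \<Longrightarrow> lends L' (Inl e) = Inl ` lends L e" "\<And>e. e \<in> S \<Longrightarrow> llen L' (Inl e) = llen L e"
  shows "connected {p \<in> Cfg (sublk L' (Inl ` V) (Inl ` S)). cmod (p (Inl u) - p (Inl v)) \<in> I} \<longleftrightarrow>
         connected {p \<in> Cfg (sublk L V S). cmod (p u - p v) \<in> I}" (is "connected ?A \<longleftrightarrow> connected ?B")
proof -
  let ?f = "\<lambda>p :: 'v \<Rightarrow> complex. case_sum p (\<lambda>_ :: 'x. 0)" and ?g = "\<lambda>p :: 'v + 'x \<Rightarrow> complex. \<lambda>x. p (Inl x)"
  have f: "?f p \<in> ?A" if p: "p \<in> ?B" for p
  proof -
    have "cmod (?f p x - ?f p y) = llen L' e'" if e: "e' \<in> Inl ` S" "lends L' e' = {x, y}" for e' x y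
    proof -
      obtain e where e': "e \<in> S" "e' = Inl e" using e(1) by blast
      then have eq: "Inl ` lends L e = {x, y}" using L'(1) e(2) by simp
      then obtain x' y' where xy: "x = Inl x'" "y = Inl y'" by (metis imageE insertI1 insertI2)
      then have "(Inl ` lends L e :: ('v + 'x) set) = Inl ` {x', y'}" using eq unfolding xy by (simp only: image_insert image_empty)
      then have "lends L e = {x', y'}" by (metis inj_Inl inj_image_eq_iff)
      then show ?thesis using p e' xy L'(2) by (auto simp: mem_Cfg_sublk)
    qed
    moreover have "?f p x = 0" if "x \<notin> Inl ` V" for x
      using p that by (cases x) (auto simp: mem_Cfg_sublk)
    ultimately show ?thesis using p by (simp add: mem_Cfg_sublk)
  qed
  have g: "?g p \<in> ?B" if p: "p \<in> ?A" for p
  proof -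
    have "cmod (p (Inl x) - p (Inl y)) = llen L e" if e: "e \<in> S" "lends L e = {x, y}" for e x y
    proof -
      have "lends L' (Inl e) = {Inl x, Inl y}" using L'(1)[OF e(1)] e(2) by simp
      then show ?thesis using p e(1) L'(2)[OF e(1)] by (auto simp: mem_Cfg_sublk)
    qed
    moreover have "p (Inl x) = 0" if "x \<notin> V" for x
    proof -
      have "(Inl x :: 'v + 'x) \<notin> Inl ` V" using that by blast
      then show ?thesis using p by (simp add: mem_Cfg_sublk)
    qed
    ultimately show ?thesis using p by (simp add: mem_Cfg_sublk)
  qed
  have fg: "?f (?g p) = p" if "p \<in> ?A" for p
  proof
    fix x show "?f (?g p) x = p x" using that by (cases x) (auto simp: mem_Cfg_sublk)
  qed
  have gf: "?g (?f p) = p" for p by simp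
  have A: "?A = ?f ` ?B"
  proof
    show "?A \<subseteq> ?f ` ?B"
    proof
      fix p assume p: "p \<in> ?A"
      show "p \<in> ?f ` ?B" by (rule image_eqI[where f="?f", OF fg[OF p, symmetric] g[OF p]])
    qed
  qed (use f in blast)
  have B: "?B = ?g ` ?A"
  proof
    show "?B \<subseteq> ?g ` ?A"
    proof
      fix p assume p: "p \<in> ?B"
      show "p \<in> ?g ` ?A" by (rule image_eqI[where f="?g", OF gf[symmetric] f[OF p]])
    qed
  qed (use g in blast)
  have cf: "continuous_on X ?f" for X
  proof (rule continuous_on_coordinatewise_then_product)
    show "continuous_on X (\<lambda>p. ?f p x)" for x
      by (cases x) (auto intro!: continuous_intros)
  qed
  have cg: "continuous_on X ?g" for X
    by (intro continuous_on_coordinatewise_then_product continuous_intros)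
  show ?thesis
  proof
    assume "connected ?A"
    then show "connected ?B" by (subst B) (intro connected_continuous_image cg)
  next
    assume "connected ?B"
    then show "connected ?A" by (subst A) (intro connected_continuous_image cf)
  qed
qed

text \<open>Q attains exactly the distances in \<open>{a..b}\<close>, so the bound holds
  automatically in \<open>L1\<close>; since all levels of Q are connected, any base point can
  provide the connected fibre.\<close>

lemma connected_Cfg_L1:
  assumes uv: "u \<noteq> v" and ab: "0 \<le> a" "a \<le> b"
  shows "connected (Cfg (L1 L EK u v a b)) \<longleftrightarrow>
      connected {p \<in> Cfg (sublk L (everts L EK \<union> {u, v}) EK). cmod (p u - p v) \<in> {a..b}}"
proof -
  let ?L = "L1 L EK u v a b" and ?c = "(b - a) / 6" and ?M = "(a + b) / 2"
  let ?V = "everts L EK \<union> {u, v}"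
  let ?X = "{p \<in> Cfg (sublk L ?V EK). cmod (p u - p v) \<in> {a..b}}"
  interpret attached_path ?L "Inr ` {1, 2, 3, 4}" "Q_path u v" "Inl u" "Inl v" "Inl ` ?V" "Inl ` EK"
    by (rule attached_path_L1[OF uv])
  \<comment> \<open>\<open>?M\<close> is the midpoint of \<open>{a..b}\<close> and
    \<open>3 * ?c\<close> half its length; \<open>3 * ?c \<le> ?M\<close> amounts to
    \<open>0 \<le> a\<close>.\<close>
  have c: "0 \<le> ?c" "3 * ?c \<le> ?M" and M: "?M - 3 * ?c = a" "?M + 3 * ?c = b"
    using ab by (simp_all add: field_simps)
  have m4: "m = 4" by simp
  have T: "linkvecs m l = linkvecs 4 (long_edge ?M ?c)"
    unfolding m4 by (rule linkvecs_cong) (rule edge_len_L1[OF uv])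
  have R: "reach = {a..b}"
    unfolding T unfolding m4 using long_edge_range[OF c] M by simp
  have lev: "connected {z \<in> linkvecs m l. cmod (\<Sum>j<m. z j) = t}" if "t \<in> {a..b}" for t
    unfolding T unfolding m4 by (rule long_edge_level_connected[OF c]) (use that M in auto)
  have base: "connected (base {a..b}) \<longleftrightarrow> connected ?X"
    unfolding base_def by (rule connected_inl_iff) (auto simp: L1_def)
  have "sublk ?L (Inl ` ?V \<union> set (Q_path u v)) (Inl ` EK \<union> Inr ` {1, 2, 3, 4}) = ?L"
    by (auto simp: sublk_def L1_def)
  moreover have "cmod (p (Inl u) - p (Inl v)) \<in> {a..b}" if "p \<in> Cfg ?L" for p
  proof -
    have "edge_vecs (Q_path u v) p \<in> linkvecs m l"
      by (rule Cfg_edge_vecs[of p "lverts ?L" "ledges ?L", unfolded sublk_self, OF that]) (auto simp: L1_def)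
    then have "cmod (\<Sum>j<m. edge_vecs (Q_path u v) p j) \<in> reach" by blast
    then show ?thesis unfolding R sum_edge_vecs by (simp only: norm_minus_commute)
  qed
  ultimately have total: "total {a..b} = Cfg ?L" unfolding total_def by auto
  show ?thesis
  proof
    assume "connected (Cfg ?L)"
    then show "connected ?X" using connected_base[of "{a..b}"] R total base by simp
  next
    assume X: "connected ?X"
    have "connected (total {a..b})"
    proof (cases "base {a..b} = {}")
      case True
      then have "total {a..b} = {}" using restr_total by blast
      then show ?thesis by simp
    next
      case False
      then obtain y1 where y1: "y1 \<in> base {a..b}" by blast
      then have "cmod (y1 (Inl u) - y1 (Inl v)) \<in> {a..b}" unfolding base_def by blast
      then show ?thesis using connected_total[of "{a..b}" y1] base X y1 lev R by blast
    qed
    then show "connected (Cfg ?L)" unfolding total .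
  qed
qed

theorem mainTheorem14:
  fixes L :: "('v, 'e) linkage" and u v :: 'v and n :: nat
    and xs :: "nat \<Rightarrow> 'v list" and Es :: "nat \<Rightarrow> 'e set" and EK :: "'e set"
    and a b :: real
  assumes wf: "wf_linkage L"
    and nonempty: "Cfg L \<noteq> {}"
    and uv: "u \<noteq> v" "u \<in> lverts L" "v \<in> lverts L"
    and n2: "n \<ge> 2"
    and paths: "\<forall>i<n. is_path L (Es i) (xs i) \<and> hd (xs i) = u \<and> last (xs i) = v"
    and pos: "\<forall>i<n. \<forall>e\<in>Es i. llen L e > 0"
    and K: "EK = {} \<or> ttsp L EK u v"
    and edges_part: "ledges L = (\<Union>i<n. Es i) \<union> EK"
    and edges_disj: "\<forall>i<n. \<forall>j<n. i \<noteq> j \<longrightarrow> Es i \<inter> Es j = {}"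
                    "\<forall>i<n. Es i \<inter> EK = {}"
    and verts_part: "lverts L = (\<Union>i<n. set (xs i)) \<union> everts L EK"
    and verts_disj: "\<forall>i<n. \<forall>j<n. i \<noteq> j \<longrightarrow> set (xs i) \<inter> set (xs j) = {u, v}"
                    "\<forall>i<n. set (xs i) \<inter> everts L EK \<subseteq> {u, v}"
    and a_def: "a = (MAX i\<in>{..<n}. Inf (dists (sublk L (set (xs i)) (Es i)) u v))"
    and b_def: "b = (MIN i\<in>{..<n}. Sup (dists (sublk L (set (xs i)) (Es i)) u v))"
    and nab: "\<forall>i<n. nabla (sublk L (set (xs i)) (Es i)) u v \<inter> dists L u v \<noteq> {}"
  shows "connected_space (Mtop L) \<longleftrightarrow> connected_space (Mtop (L1 L EK u v a b))"
proof -
  let ?P = "\<lambda>i. sublk L (set (xs i)) (Es i)"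
  let ?D = "\<lambda>i. dists (?P i) u v"
  have lends: "lends L e \<subseteq> lverts L" if "e \<in> ledges L" for e
    using wf that by (auto simp: wf_linkage_def)
  have pil: "path_in_linkage L (Es i) (xs i) u v" if "i < n" for i
    using paths that by unfold_locales auto
  have dist_D: "cmod (p u - p v) \<in> ?D i" if p: "p \<in> Cfg L" and i: "i < n" for p i
  proof -
    interpret path_in_linkage L "Es i" "xs i" u v by (rule pil[OF i])
    have "restr (set (xs i)) p \<in> Cfg (?P i)"
    proof (rule restr_Cfg)
      show "p \<in> Cfg (sublk L (lverts L) (ledges L))" using p by (simp only: sublk_self)
      show "Es i \<subseteq> ledges L" unfolding edges_part using i by blast
    qed (rule edges_within)
    moreover have "cmod (p u - p v) = cmod (restr (set (xs i)) p u - restr (set (xs i)) p v)"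
      using uv_mem by (simp add: restr_def)
    ultimately show ?thesis unfolding dists_def by blast
  qed
  obtain p0 where p0: "p0 \<in> Cfg L" using nonempty by blast
  have D: "?D i = {Inf (?D i)..Sup (?D i)}" "0 \<le> Inf (?D i)" if "i < n" for i
    using path_in_linkage.dists_interval[OF pil[OF that]] dist_D[OF p0 that] by blast+
  have ab: "Inf (?D i) \<le> a" "b \<le> Sup (?D i)" if "i < n" for i
    unfolding a_def b_def using that by (auto intro!: Max_ge Min_le)
  have sub: "{a..b} \<subseteq> ?D i" if "i < n" for i
    using ab[OF that] by (subst D(1)[OF that]) auto
  \<comment> \<open>Each path bounds the terminal distance, and all these bounds hold at once;
    applied to \<open>p0\<close> this also yields \<open>a \<le> b\<close>.\<close>
  have dist_ab: "cmod (p u - p v) \<in> {a..b}" if p: "p \<in> Cfg L" for p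
  proof -
    have "Inf (?D i) \<le> cmod (p u - p v)" "cmod (p u - p v) \<le> Sup (?D i)" if "i < n" for i
      using dist_D[OF p that] by (subst (asm) D(1)[OF that], simp)+
    moreover have "{..<n} \<noteq> {}" using n2 by (simp add: lessThan_empty_iff)
    ultimately show ?thesis unfolding a_def b_def by (simp add: Max_le_iff Min_ge_iff)
  qed
  have "0 \<le> a" using D(2)[of 0] ab(1)[of 0] n2 by simp
  moreover have "a \<le> b" using dist_ab[OF p0] by simp
  ultimately have L1: "connected (Cfg (L1 L EK u v a b)) \<longleftrightarrow>
      connected {p \<in> Cfg (sublk L (everts L EK \<union> {u, v}) EK). cmod (p u - p v) \<in> {a..b}}"
    by (rule connected_Cfg_L1[OF uv(1)])
  \<comment> \<open>\<open>X k\<close> keeps K and the first \<open>k\<close> paths, but the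
    distance bound coming from all \<open>n\<close> paths at every stage, so a step changes only the
    path, never the permitted distances. At \<open>k = n\<close> the bound is automatic.\<close>
  define V where "V k = everts L EK \<union> {u, v} \<union> (\<Union>i<k. set (xs i))" for k
  define S where "S k = EK \<union> (\<Union>i<k. Es i)" for k
  define X where "X k = {p \<in> Cfg (sublk L (V k) (S k)). cmod (p u - p v) \<in> {a..b}}" for k
  have att: "attached_path L (Es k) (xs k) u v (V k) (S k)" if k: "k < n" for k
  proof -
    interpret path_in_linkage L "Es k" "xs k" u v by (rule pil[OF k])
    show ?thesis
    proof
      have "set (xs k) \<inter> set (xs i) = {u, v}" if "i < k" for i
        using verts_disj(1) k that by auto
      then show "set (xs k) \<inter> V k = {u, v}"
        using verts_disj(2) k uv_mem unfolding V_def by blast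
      fix e assume "e \<in> S k"
      then consider "e \<in> EK" | i where "i < k" "e \<in> Es i" unfolding S_def by blast
      then show "lends L e \<subseteq> V k"
      proof cases
        case (2 i)
        then show ?thesis
          using path_in_linkage.edges_within[OF pil, of i e] k unfolding V_def by fastforce
      qed (auto simp: V_def)
    qed
  qed
  have Xn: "X n = Cfg L"
  proof -
    have "V n = lverts L" "S n = ledges L"
      using verts_part uv(2,3) edges_part unfolding V_def S_def by auto
    then show ?thesis unfolding X_def using dist_ab by (auto simp: sublk_self)
  qed
  have step: "connected (X (Suc k)) \<longleftrightarrow> connected (X k)" if k: "k < n" for k
  proof -
    interpret attached_path L "Es k" "xs k" u v "V k" "S k" by (rule att[OF k])
    have R: "{a..b} \<subseteq> reach" using sub[OF k] unfolding dists_eq .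
    have b: "base {a..b} = X k" unfolding base_def X_def ..
    have "V (Suc k) = V k \<union> set (xs k)" "S (Suc k) = S k \<union> Es k"
      unfolding V_def S_def lessThan_Suc by auto
    then have t: "total {a..b} = X (Suc k)" unfolding total_def X_def by simp
    show ?thesis
    proof
      assume "connected (X (Suc k))"
      then show "connected (X k)" using connected_base[OF _ R] unfolding t b by blast
    next
      assume con: "connected (X k)"
      \<comment> \<open>The common element of \<open>nabla\<close> and \<open>dists L u v\<close> is
        realised by a configuration of all of \<open>L\<close>. Its restriction is a base point over
        which the fibre of path \<open>k\<close> is connected.\<close>
      obtain x where x: "x \<in> nabla (?P k) u v" "x \<in> dists L u v" using nab k by blast
      obtain p where p: "p \<in> Cfg L" "cmod (p u - p v) = x" using x(2) unfolding dists_def by blast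
      have "restr (V k) p \<in> Cfg (sublk L (V k) (S k))"
      proof (rule restr_Cfg)
        show "p \<in> Cfg (sublk L (lverts L) (ledges L))" using p(1) by (simp only: sublk_self)
        show "S k \<subseteq> ledges L" unfolding edges_part S_def using k by fastforce
      qed (rule within)
      moreover have px: "cmod (restr (V k) p u - restr (V k) p v) = x"
        using uv_V p(2) by (simp add: restr_def)
      ultimately have "restr (V k) p \<in> base {a..b}"
        using dist_ab[OF p(1)] p(2) unfolding base_def by simp
      moreover have "connected {q \<in> Cfg (?P k). cmod (q u - q v) = x}"
        by (rule nabla_level_connected[OF _ _ _ x(1)]) (use edges_within uv_mem in auto)
      then have "connected {z \<in> linkvecs m l. cmod (\<Sum>j<m. z j) = cmod (restr (V k) p u - restr (V k) p v)}"
        unfolding px by (rule level_connected)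
      moreover have "\<forall>j<m. l j > 0" using l_pos pos k by blast
      ultimately have "connected (total {a..b})"
        using connected_total[OF _ R] con unfolding b by blast
      then show "connected (X (Suc k))" unfolding t .
    qed
  qed
  have chain: "k \<le> n \<Longrightarrow> connected (X k) \<longleftrightarrow> connected (X 0)" for k
    by (induction k) (use step in auto)
  have "connected (Cfg L) \<longleftrightarrow> connected (X 0)" unfolding Xn[symmetric] by (rule chain) simp
  also have "X 0 = {p \<in> Cfg (sublk L (everts L EK \<union> {u, v}) EK). cmod (p u - p v) \<in> {a..b}}"
    by (simp add: X_def V_def S_def)
  also note L1[symmetric]
  finally have "connected (Cfg L) \<longleftrightarrow> connected (Cfg (L1 L EK u v a b))" .
  moreover have "lends (L1 L EK u v a b) e \<subseteq> lverts (L1 L EK u v a b)" if "e \<in> ledges (L1 L EK u v a b)" for e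
  proof (cases e)
    case (Inl e')
    then have "e' \<in> EK" using that by (auto simp: L1_def)
    then have "Inl ` lends L e' \<subseteq> Inl ` (everts L EK \<union> {u, v})" by (intro image_mono) blast
    then show ?thesis
      unfolding Inl L1_lends by (simp only: L1_def linkage.select_convs) (rule le_supI1)
  qed (auto simp: L1_def)
  ultimately show ?thesis
    using connected_Mtop_iff[of L] connected_Mtop_iff[of "L1 L EK u v a b"] lends by blast
qed

end
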